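(* Let $\alpha,\beta$ be reals with $1/\sqrt{2}\leqslant\alpha<3/4$ and $\mathscr{B}(\alpha)\leqslant\beta\leqslant\alpha^2$, where $\mathscr{B}(\alpha)=(\sqrt{1+4\alpha}-1)/2$. Let $\mathcal{T}$ be a $\mathrm{GCB}_{\alpha,\beta}$-tree (a binary search tree all of whose nodes are $(\alpha,\beta)$-balanced). The tree obtained by using the bottom-up update algorithm to insert a leaf into $\mathcal{T}$ or delete a node from $\mathcal{T}$ is also a $\mathrm{GCB}_{\alpha,\beta}$-tree.
   Context: Weights: the weight $|\mathcal{T}|$ of a binary search tree is its number of empty sub-trees (number of nodes plus one); the weight $|n|$ of a node is the weight of its sub-tree. Each empty tree (weight 1) is viewed as an infinite complete binary tree whose depth-$d$ nodes have weight $2^{-d}$. For a node $n$, its left/right children are $n_1,n_2$, the children of $n_i$ are $n_{i1},n_{i2}$, and so on. $\mathsf{bal_C}(n)=\max\{|n_1|,|n_2|\}/|n|$, $\mathsf{bal_{GC}}(n)=\max_{i,j}|n_{ij}|/|n|$; $n$ is $(x,y)$-balanced if $\mathsf{bal_C}(n)\leqslant x$ and $\mathsf{bal_{GC}}(n)\leqslant y$. Rotations on a tree with root $n$: the simple rotation makes $n_1$ the root, with children $n_{11}$ and $n$, where $n$ now has children $n_{12}$ and $n_2$; the double rotation makes $n_{12}$ the root, with left child $n_1$ (children $n_{11},n_{121}$) and right child $n$ (children $n_{122},n_2$). Mirror images exchange left and right. $\mathsf{C}(u,v,w,x)$-balancing, on a tree with root $n$: if $|n_1|>u|n|+w$ and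 $|n_{11}|\geqslant(1-v)|n|-x$, simple rotation; if $|n_2|>u|n|+w$ and $|n_{22}|\geqslant(1-v)|n|-x$, its mirror; if $|n_1|>u|n|+w$ and $|n_{11}|<(1-v)|n|-x$, double rotation; if $|n_2|>u|n|+w$ and $|n_{22}|<(1-v)|n|-x$, its mirror; otherwise do nothing. $\mathsf{GC}(y,z)$-balancing: if $|n_{11}|>y|n|+z$, simple rotation; if $|n_{22}|>y|n|+z$, its mirror; if $|n_{12}|>y|n|+z$, double rotation; if $|n_{21}|>y|n|+z$, its mirror; otherwise do nothing. $\mathsf{C}\mathsf{GC}(u,v,y,\hat{y})$-balancing, on input $\mathcal{T}$: apply $\mathsf{C}(u,v,0,0)$-balancing, obtaining $\mathcal{T}^{(1)}$; if $\mathcal{T}\neq\mathcal{T}^{(1)}$, apply $\mathsf{GC}(\hat{y},0)$-balancing to the left and right sub-trees of $\mathcal{T}^{(1)}$, then $\mathsf{GC}(\hat{y},0)$-balancing to the resulting whole tree; otherwise apply $\mathsf{GC}(y,0)$-balancing to $\mathcal{T}$. Updates: inserting a key replaces an empty sub-tree by a new leaf $s$; deleting a key is reduced to deleting a leaf $s$ (if the node holding the key is not a leaf, one deletes instead a suitable leaf descendant of it, namely its only child or its in-order successor, and copies that leaf's key into it). An update is redundant if the key to insert is already present or the key to delete is absent; it then changes no weight. The bottom-up update algorithm, with $\hat{\alpha}=\dfrac{1-2\alpha+6\alpha^2-\sqrt{(1-\alpha)(5-\alpha)}}{5(2\alpha-1)}$ and $\hat{\beta}=\dfrac{1+\alpha-\sqrt{(1-\alpha)^2+4\alpha(\alpha^2-\beta)}}{2(1-\alpha^2+\beta)}\alpha$,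 operates on a tree $\mathcal{T}$ as follows: if $\mathcal{T}$ has at most $11$ nodes, insert or delete $s$ (if possible) and restructure the resulting tree into a perfectly balanced tree (one in which the weights of any two siblings differ by at most $1$); otherwise (1) recursively apply the algorithm to the left or right sub-tree in which $s$ lies, then (2) if the update is non-redundant, update the weight of the root and apply the $\mathsf{C}\mathsf{GC}(\alpha,\hat{\alpha},\beta,\hat{\beta})$-balancing algorithm to $\mathcal{T}$. *)

theory Defs
  imports Complex_Main "HOL-Library.Tree"
begin

section \<open>Weights and balance\<close>

datatype dir = L | R

text \<open>\<open>weight t ds\<close> is the weight of the node reached from the root of \<open>t\<close> along \<open>ds\<close>.
  An empty tree is viewed as an infinite complete binary tree whose nodes at depth \<open>d\<close> have
  weight \<open>1 / 2^d\<close>. With \<open>n\<close> the root of \<open>t\<close>: \<open>|n|\<close> is \<open>weight t []\<close>, \<open>|n\<^sub>1|\<close> is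
  \<open>weight t [L]\<close>, \<open>|n\<^sub>1\<^sub>2|\<close> is \<open>weight t [L, R]\<close>, and so on.\<close>

fun weight :: "'a tree \<Rightarrow> dir list \<Rightarrow> real" where
  "weight t [] = real (size1 t)"
| "weight \<langle>\<rangle> (d # ds) = (1/2) ^ length (d # ds)"
| "weight \<langle>l, a, r\<rangle> (d # ds) = weight (if d = L then l else r) ds"

definition bal_C :: "'a tree \<Rightarrow> real" where
  "bal_C t = max (weight t [L]) (weight t [R]) / weight t []"

definition bal_GC :: "'a tree \<Rightarrow> real" where
  "bal_GC t =
     max (max (weight t [L,L]) (weight t [L,R])) (max (weight t [R,L]) (weight t [R,R]))
       / weight t []"

definition balanced :: "real \<Rightarrow> real \<Rightarrow> 'a tree \<Rightarrow> bool" where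
  "balanced x y t \<longleftrightarrow> bal_C t \<le> x \<and> bal_GC t \<le> y"

text \<open>Empty trees (and the nodes below them) have \<open>bal_C = 1/2\<close> and \<open>bal_GC = 1/4\<close>; only proper
  nodes are constrained.\<close>

definition GCB :: "real \<Rightarrow> real \<Rightarrow> 'a::linorder tree \<Rightarrow> bool" where
  "GCB \<alpha> \<beta> t \<longleftrightarrow> bst t \<and> (\<forall>s\<in>subtrees t. s \<noteq> \<langle>\<rangle> \<longrightarrow> balanced \<alpha> \<beta> s)"


section \<open>Rotations and balancing\<close>

text \<open>A rotation leaves the tree alone if one of the nodes it has to lift is an empty tree.
  In the balancing procedures below, the conditions guarding a rotation exclude that case as soon
  as the offsets \<open>w\<close>, \<open>x\<close>, \<open>z\<close> are \<open>0\<close> and \<open>u \<ge> 1/2\<close>, \<open>u + v - 1 \<ge> 1/3\<close>, \<open>y \<ge> 1/3\<close>.\<close>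

fun simple_rot :: "'a tree \<Rightarrow> 'a tree" where
  "simple_rot \<langle>\<langle>t11, k1, t12\<rangle>, k, t2\<rangle> = \<langle>t11, k1, \<langle>t12, k, t2\<rangle>\<rangle>"
| "simple_rot t = t"

fun simple_rot_mirror :: "'a tree \<Rightarrow> 'a tree" where
  "simple_rot_mirror \<langle>t1, k, \<langle>t21, k2, t22\<rangle>\<rangle> = \<langle>\<langle>t1, k, t21\<rangle>, k2, t22\<rangle>"
| "simple_rot_mirror t = t"

fun double_rot :: "'a tree \<Rightarrow> 'a tree" where
  "double_rot \<langle>\<langle>t11, k1, \<langle>t121, k12, t122\<rangle>\<rangle>, k, t2\<rangle>
     = \<langle>\<langle>t11, k1, t121\<rangle>, k12, \<langle>t122, k, t2\<rangle>\<rangle>"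
| "double_rot t = t"

fun double_rot_mirror :: "'a tree \<Rightarrow> 'a tree" where
  "double_rot_mirror \<langle>t1, k, \<langle>\<langle>t211, k21, t212\<rangle>, k2, t22\<rangle>\<rangle>
     = \<langle>\<langle>t1, k, t211\<rangle>, k21, \<langle>t212, k2, t22\<rangle>\<rangle>"
| "double_rot_mirror t = t"

definition C_balance :: "real \<Rightarrow> real \<Rightarrow> real \<Rightarrow> real \<Rightarrow> 'a tree \<Rightarrow> 'a tree" where
  "C_balance u v w x t =
     (let n = weight t [] in
      if weight t [L] > u * n + w \<and> weight t [L,L] \<ge> (1 - v) * n - x then simple_rot t
      else if weight t [R] > u * n + w \<and> weight t [R,R] \<ge> (1 - v) * n - x then simple_rot_mirror t
      else if weight t [L] > u * n + w \<and> weight t [L,L] < (1 - v) * n - x then double_rot t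
      else if weight t [R] > u * n + w \<and> weight t [R,R] < (1 - v) * n - x then double_rot_mirror t
      else t)"

definition GC_balance :: "real \<Rightarrow> real \<Rightarrow> 'a tree \<Rightarrow> 'a tree" where
  "GC_balance y z t =
     (let n = weight t [] in
      if weight t [L,L] > y * n + z then simple_rot t
      else if weight t [R,R] > y * n + z then simple_rot_mirror t
      else if weight t [L,R] > y * n + z then double_rot t
      else if weight t [R,L] > y * n + z then double_rot_mirror t
      else t)"

fun map_children :: "('a tree \<Rightarrow> 'a tree) \<Rightarrow> 'a tree \<Rightarrow> 'a tree" where
  "map_children f \<langle>\<rangle> = \<langle>\<rangle>"
| "map_children f \<langle>l, a, r\<rangle> = \<langle>f l, a, f r\<rangle>"

definition CGC_balance :: "real \<Rightarrow> real \<Rightarrow> real \<Rightarrow> real \<Rightarrow> 'a tree \<Rightarrow> 'a tree" where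
  "CGC_balance u v y y' t =
     (let t1 = C_balance u v 0 0 t in
      if t \<noteq> t1 then GC_balance y' 0 (map_children (GC_balance y' 0) t1)
      else GC_balance y 0 t)"


section \<open>Parameters\<close>

definition B_thr :: "real \<Rightarrow> real" where
  "B_thr \<alpha> = (sqrt (1 + 4 * \<alpha>) - 1) / 2"

definition alpha_hat :: "real \<Rightarrow> real" where
  "alpha_hat \<alpha> =
     (1 - 2 * \<alpha> + 6 * \<alpha>\<^sup>2 - sqrt ((1 - \<alpha>) * (5 - \<alpha>))) / (5 * (2 * \<alpha> - 1))"

definition beta_hat :: "real \<Rightarrow> real \<Rightarrow> real" where
  "beta_hat \<alpha> \<beta> =
     (1 + \<alpha> - sqrt ((1 - \<alpha>)\<^sup>2 + 4 * \<alpha> * (\<alpha>\<^sup>2 - \<beta>))) / (2 * (1 - \<alpha>\<^sup>2 + \<beta>)) * \<alpha>"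


section \<open>Updates\<close>

fun leaf_insert :: "'a::linorder \<Rightarrow> 'a tree \<Rightarrow> 'a tree" where
  "leaf_insert x \<langle>\<rangle> = \<langle>\<langle>\<rangle>, x, \<langle>\<rangle>\<rangle>"
| "leaf_insert x \<langle>l, a, r\<rangle> =
     (if x < a then \<langle>leaf_insert x l, a, r\<rangle>
      else if a < x then \<langle>l, a, leaf_insert x r\<rangle>
      else \<langle>l, a, r\<rangle>)"

text \<open>The key of a non-leaf node is replaced by that of its in-order successor within its sub-tree
  (which is its only child, if it has just a right child that is a leaf), and the successor is
  deleted in turn until a leaf is reached. A node without right child uses its in-order
  predecessor instead: in a balanced tree this is its only child, which is a leaf.\<close>

fun leaf_delete :: "'a::linorder \<Rightarrow> 'a tree \<Rightarrow> 'a tree" where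
  "leaf_delete x \<langle>\<rangle> = \<langle>\<rangle>"
| "leaf_delete x \<langle>l, a, r\<rangle> =
     (if x < a then \<langle>leaf_delete x l, a, r\<rangle>
      else if a < x then \<langle>l, a, leaf_delete x r\<rangle>
      else if r \<noteq> \<langle>\<rangle> then let m = hd (inorder r) in \<langle>l, m, leaf_delete m r\<rangle>
      else if l \<noteq> \<langle>\<rangle> then let m = last (inorder l) in \<langle>leaf_delete m l, m, r\<rangle>
      else \<langle>\<rangle>)"

text \<open>Which perfectly balanced tree a small tree is restructured into is left open. Since an update
  restructures at most once, quantifying over all functions \<open>f\<close> below covers all choices.\<close>

definition restructuring :: "('a tree \<Rightarrow> 'a tree) \<Rightarrow> bool" where
  "restructuring f \<longleftrightarrow> (\<forall>t. wbalanced (f t) \<and> inorder (f t) = inorder t)"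

lemma ex_restructuring: "\<exists>f :: 'a tree \<Rightarrow> 'a tree. restructuring f"
proof -
  have "\<exists>t. wbalanced t \<and> inorder t = xs" for xs :: "'a list"
  proof (induction xs rule: length_induct)
    case (1 xs)
    show ?case
    proof (cases "xs = []")
      case True
      then have "wbalanced \<langle>\<rangle> \<and> inorder \<langle>\<rangle> = xs" by simp
      then show ?thesis by blast
    next
      case False
      define n where "n = length xs div 2"
      have n: "n < length xs" using False by (simp add: n_def)
      obtain l where l: "wbalanced l" "inorder l = take n xs" using 1 n by force
      obtain r where r: "wbalanced r" "inorder r = drop (Suc n) xs" using 1 n
        by (metis False diff_less length_drop length_greater_0_conv zero_less_Suc)
      have "size l = n" "size r = length xs - Suc n"
        using l r n length_inorder[of l] length_inorder[of r] by simp_all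
      then have "\<bar>int (size l) - int (size r)\<bar> \<le> 1" using n unfolding n_def by linarith
      moreover have "inorder \<langle>l, xs ! n, r\<rangle> = xs" using l r n by (simp add: id_take_nth_drop[symmetric])
      ultimately have "wbalanced \<langle>l, xs ! n, r\<rangle> \<and> inorder \<langle>l, xs ! n, r\<rangle> = xs" using l r by simp
      then show ?thesis by blast
    qed
  qed
  then have "\<forall>t :: 'a tree. \<exists>t'. wbalanced t' \<and> inorder t' = inorder t" by blast
  from choice[OF this] show ?thesis unfolding restructuring_def .
qed

text \<open>In both functions, the test on \<open>set_tree\<close> tells whether the update is non-redundant.\<close>

fun bu_insert :: "('a tree \<Rightarrow> 'a tree) \<Rightarrow> real \<Rightarrow> real \<Rightarrow> 'a::linorder \<Rightarrow> 'a tree \<Rightarrow> 'a tree" where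
  "bu_insert f \<alpha> \<beta> x \<langle>\<rangle> = f (leaf_insert x \<langle>\<rangle>)"
| "bu_insert f \<alpha> \<beta> x \<langle>l, a, r\<rangle> =
     (if size \<langle>l, a, r\<rangle> \<le> 11 then f (leaf_insert x \<langle>l, a, r\<rangle>)
      else
        let t' = (if x < a then \<langle>bu_insert f \<alpha> \<beta> x l, a, r\<rangle>
                  else if a < x then \<langle>l, a, bu_insert f \<alpha> \<beta> x r\<rangle>
                  else \<langle>l, a, r\<rangle>)
        in if x \<notin> set_tree \<langle>l, a, r\<rangle>
           then CGC_balance \<alpha> (alpha_hat \<alpha>) \<beta> (beta_hat \<alpha> \<beta>) t'
           else t')"

fun bu_delete :: "('a tree \<Rightarrow> 'a tree) \<Rightarrow> real \<Rightarrow> real \<Rightarrow> 'a::linorder \<Rightarrow> 'a tree \<Rightarrow> 'a tree" where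
  "bu_delete f \<alpha> \<beta> x \<langle>\<rangle> = f (leaf_delete x \<langle>\<rangle>)"
| "bu_delete f \<alpha> \<beta> x \<langle>l, a, r\<rangle> =
     (if size \<langle>l, a, r\<rangle> \<le> 11 then f (leaf_delete x \<langle>l, a, r\<rangle>)
      else
        let t' = (if x < a then \<langle>bu_delete f \<alpha> \<beta> x l, a, r\<rangle>
                  else if a < x then \<langle>l, a, bu_delete f \<alpha> \<beta> x r\<rangle>
                  else if r \<noteq> \<langle>\<rangle> then let m = hd (inorder r) in \<langle>l, m, bu_delete f \<alpha> \<beta> m r\<rangle>
                  else let m = last (inorder l) in \<langle>bu_delete f \<alpha> \<beta> m l, m, r\<rangle>)
        in if x \<in> set_tree \<langle>l, a, r\<rangle>
           then CGC_balance \<alpha> (alpha_hat \<alpha>) \<beta> (beta_hat \<alpha> \<beta>) t'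
           else t')"

end

theory Submission
  imports Defs
begin

text \<open>Put \<open>B = B_thr \<alpha>\<close>, so that \<open>\<alpha> = B + B\<^sup>2\<close>, with \<open>B \<le> 1/2\<close> because \<open>\<alpha> \<le> 3/4\<close>. If both sub-trees of a
  tree are balanced and its root satisfies \<open>bal_C \<le> \<alpha>\<close>, then GC-balancing with any threshold in
  \<open>[B, \<beta>]\<close> balances the tree: every required inequality between weights is linear in the weights and
  reduces to a polynomial inequality in \<open>B\<close> and \<open>\<beta>\<close>. Both \<open>\<beta>\<close> and \<open>beta_hat\<close> are such thresholds.
  If the root violates \<open>bal_C \<le> \<alpha>\<close> after an update, it does so by a factor of at most \<open>13/12\<close>, and the
  bounds \<open>1 - \<alpha>\<^sup>2 / (1 + \<alpha>) \<le> alpha_hat \<le> \<alpha>\<close> ensure that the C-rotation restores \<open>bal_C \<le> \<alpha>\<close> at the root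
  and at its children, to which GC-balancing then applies.\<close>

section \<open>Weights after a rotation\<close>

text \<open>The square roots of the hypotheses are replaced by polynomial relations:
  \<open>\<alpha>_square\<close> stands for \<open>1 / sqrt 2 \<le> \<alpha>\<close>, and
  \<open>\<alpha>_eq\<close> with \<open>B_pos\<close> pins \<open>B\<close> down as
  \<open>B_thr \<alpha>\<close>.\<close>

locale gcb_parameters =
  fixes \<alpha> \<beta> B :: real
  assumes \<alpha>_pos: "0 < \<alpha>" and \<alpha>_square: "1 \<le> 2 * \<alpha>\<^sup>2" and \<alpha>_upper: "\<alpha> < 3/4"
    and \<alpha>_eq: "\<alpha> = B + B * B" and B_pos: "0 < B"
    and \<beta>_ge_B: "B \<le> \<beta>" and \<beta>_le: "\<beta> \<le> \<alpha> * \<alpha>"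
begin

section \<open>Numeric bounds on the parameters\<close>

lemma \<alpha>_gt: "7/10 < \<alpha>"
proof (rule ccontr)
  assume "\<not> 7/10 < \<alpha>"
  then have "\<alpha>\<^sup>2 \<le> (7/10)\<^sup>2" using \<alpha>_pos by (intro power_mono) auto
  then show False using \<alpha>_square by (simp add: power2_eq_square)
qed

lemma B_le_half: "B \<le> 1/2"
proof (rule ccontr)
  assume "\<not> B \<le> 1/2"
  then have "1/2 * (1/2) \<le> B * B" by (intro mult_mono) auto
  then show False using \<alpha>_eq \<alpha>_upper \<open>\<not> B \<le> 1/2\<close> by simp
qed

lemma B_gt: "46/100 < B"
proof (rule ccontr)
  assume "\<not> 46/100 < B"
  then have "B * B \<le> 46/100 * (46/100)" using B_pos by (intro mult_mono) auto
  then show False using \<alpha>_eq \<alpha>_gt \<open>\<not> 46/100 < B\<close> by simp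
qed

lemma \<alpha>_square_less: "\<alpha> * \<alpha> < \<alpha>"
  using \<alpha>_gt \<alpha>_upper mult_strict_right_mono[of \<alpha> 1 \<alpha>] by simp

lemma \<alpha>_square_le: "\<alpha> * \<alpha> \<le> 9/16"
  using mult_mono[of \<alpha> "3/4" \<alpha> "3/4"] \<alpha>_pos \<alpha>_upper by simp

lemma \<beta>_upper: "\<beta> \<le> 9/16"
  using \<beta>_le \<alpha>_square_le by simp

lemmas params = \<alpha>_square_le \<beta>_upper \<alpha>_gt \<alpha>_upper B_pos B_le_half B_gt \<beta>_ge_B \<beta>_le \<alpha>_square_less

text \<open>The first bound rearranges to \<open>(2 * B - 1) * (B + 1) \<le> 0\<close>, that is, to
  \<open>B \<le> 1/2\<close>; so does \<open>two_\<alpha>\<close> below.\<close>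

lemma B_square_le: "B * B \<le> 1 - \<alpha>" "B * B \<le> B * (1 - B)" "B * B \<le> 1/4"
proof -
  show "B * B \<le> 1/4" using mult_mono[OF B_le_half B_le_half] B_pos by simp
  then show "B * B \<le> 1 - \<alpha>" using \<alpha>_eq B_le_half by linarith
  show "B * B \<le> B * (1 - B)" using B_le_half B_pos by (intro mult_left_mono) auto
qed

lemma two_\<alpha>: "2 * \<alpha> - 1 \<le> B"
  using B_square_le \<alpha>_eq B_le_half by linarith

lemma \<alpha>_cube: "\<alpha> * (\<alpha> * \<alpha>) \<le> B"
proof -
  have "\<alpha> * (\<alpha> * \<alpha>) \<le> 3/4 * (3/4 * (3/4))"
    using params by (intro mult_mono) auto
  then show ?thesis using B_gt by simp
qed

text \<open>Since \<open>\<alpha> = B + B * B\<close>, the second bound amounts to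
  \<open>B \<le> \<alpha> * \<alpha>\<close>, which holds because \<beta> lies between the two. The
  first bound is weaker, as \<open>\<alpha> < 1\<close>.\<close>

lemma \<alpha>_le_B: "\<alpha> \<le> (1 + \<alpha>) * B"  "\<alpha> \<le> (1 + \<alpha> * \<alpha>) * B"
proof -
  have "B * B \<le> \<alpha> * \<alpha> * B" using params by (intro mult_right_mono) auto
  then show 1: "\<alpha> \<le> (1 + \<alpha> * \<alpha>) * B" using \<alpha>_eq by (simp add: algebra_simps)
  have "\<alpha> * \<alpha> * B \<le> \<alpha> * B" using params by (intro mult_right_mono) auto
  then show "\<alpha> \<le> (1 + \<alpha>) * B" using 1 by (simp add: algebra_simps)
qed

section \<open>Weights under the rotations of GC-balancing\<close>

lemma other_child_le:
  fixes a m n :: real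
  assumes "0 < n" "B * n \<le> a" "a \<le> \<alpha> * m"
  shows "n - m \<le> \<beta> * n"
proof -
  \<comment> \<open>The factorisation \<open>\<alpha> = B * (1 + B)\<close> turns a grandchild of
    weight at least \<open>B * n\<close> into a parent of weight at least
    \<open>n / (1 + B)\<close>, leaving at most \<open>B * n / (1 + B)\<close> for the other
    child.\<close>
  have "B * ((1 + B) * (n - m)) = \<alpha> * n - \<alpha> * m" using \<alpha>_eq by (simp add: algebra_simps)
  also have "\<dots> \<le> \<alpha> * n - B * n" using assms by simp
  also have "\<dots> = B * (B * n)" using \<alpha>_eq by (simp add: algebra_simps)
  finally have *: "(1 + B) * (n - m) \<le> B * n" using B_pos by simp
  have "n - m \<le> B * n"
  proof (cases "n - m \<le> 0")
    case True
    then show ?thesis using B_pos assms(1) mult_pos_pos[of B n] by linarith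
  next
    case False
    then have "0 < B * (n - m)" using B_pos by simp
    then show ?thesis using * by (simp add: algebra_simps)
  qed
  also have "\<dots> \<le> \<beta> * n" using \<beta>_ge_B assms(1) by simp
  finally show ?thesis .
qed

text \<open>In the following lemmas, \<open>n\<close> is the weight of the root, \<open>a\<close> that of \<open>n\<^sub>1\<^sub>1\<close> and \<open>d\<close> that of
  \<open>n\<^sub>2\<close>; the weight of \<open>n\<^sub>1\<^sub>2\<close> is \<open>c\<close>, or \<open>p + q\<close> if this node is split by a double rotation. A term
  such as \<open>\<alpha> * a\<close> stands for the weight of any child of the node of weight \<open>a\<close>.\<close>

lemma simple_rot_weights:
  fixes a c d n :: real
  assumes pos: "0 < a" "0 < c" "0 < d" and n: "n = a + c + d"
    and m: "a + c \<le> \<alpha> * n" and a: "a \<le> \<alpha> * (a + c)" and B: "B * n \<le> a"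
  shows "a \<le> \<alpha> * n" "c + d \<le> \<alpha> * n" "\<alpha> * a \<le> \<beta> * n" "c \<le> \<beta> * n" "d \<le> \<beta> * n"
    "c \<le> \<alpha> * (c + d)" "d \<le> \<alpha> * (c + d)" "\<alpha> * c \<le> \<beta> * (c + d)" "\<alpha> * d \<le> \<beta> * (c + d)"
proof -
  have n0: "0 < n" using pos n by simp
  have \<beta>n: "B * n \<le> \<beta> * n" using \<beta>_ge_B n0 by simp
  show "a \<le> \<alpha> * n" using m pos by simp
  have "1 - \<alpha> \<le> B" using params by linarith
  from mult_right_mono[OF this, of n] show "c + d \<le> \<alpha> * n" using B n n0 by (simp add: algebra_simps)
  \<comment> \<open>A child of \<open>a\<close> was three levels below the root, so it weighs at
    most \<open>\<alpha>^3 * n\<close>, and \<open>\<alpha>_cube\<close> applies.\<close>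
  have "\<alpha> * (a + c) \<le> \<alpha> * (\<alpha> * n)" using m params by (intro mult_left_mono) auto
  with a have "a \<le> \<alpha> * (\<alpha> * n)" by linarith
  then have "\<alpha> * a \<le> \<alpha> * (\<alpha> * (\<alpha> * n))" using params by (intro mult_left_mono) auto
  also have "\<dots> \<le> B * n" using mult_right_mono[OF \<alpha>_cube, of n] n0 by (simp add: mult.assoc)
  finally show "\<alpha> * a \<le> \<beta> * n" using \<beta>n by simp
  have "c \<le> (B * B) * n" using m B \<alpha>_eq by (simp add: algebra_simps)
  also have "\<dots> \<le> B * n" using n0 params mult_left_le[of B B] by (intro mult_right_mono) auto
  finally show "c \<le> \<beta> * n" using \<beta>n by simp
  show "d \<le> \<beta> * n" using other_child_le[OF n0 B a] n by simp
  have cd: "c + d = n - a" using n by simp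
  have "\<alpha> * a \<le> a" using params pos by simp
  then show "c \<le> \<alpha> * (c + d)" using m unfolding cd by (simp add: algebra_simps)
  have d: "\<alpha> * d \<le> \<alpha> * n - a" using a n by (simp add: algebra_simps)
  have "\<alpha> * n \<le> (1 + \<alpha>) * B * n" using mult_right_mono[OF \<alpha>_le_B(1), of n] n0 by simp
  also have "\<dots> \<le> (1 + \<alpha>) * a"
    unfolding mult.assoc using B params by (intro mult_left_mono) auto
  finally have "(1 - \<alpha>) * (\<alpha> * n) \<le> (1 - \<alpha>) * ((1 + \<alpha>) * a)"
    using params by (intro mult_left_mono) auto
  then have "\<alpha> * d \<le> \<alpha> * (\<alpha> * (n - a))" using d by (simp add: algebra_simps)
  then show "d \<le> \<alpha> * (c + d)" using params unfolding cd by simp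
  \<comment> \<open>\<open>*\<close> and \<open>**\<close> are what the last two conclusions require
    in the extreme case \<open>a = B * n\<close>. Both ask for \<open>\<beta> * (1 - B)\<close> to
    be large enough, so that \<open>B \<le> \<beta>\<close> reduces them to a comparison with
    \<open>B * (1 - B)\<close>.\<close>
  have "\<beta> * (1 - B) \<ge> B * (1 - B)" using params by (intro mult_right_mono) auto
  then have *: "\<alpha> - \<beta> \<le> (1 - \<beta>) * B" using \<alpha>_eq B_square_le(2) by (simp add: algebra_simps)
  have "\<alpha> * B \<le> 3/4 * (1/2)" using params by (intro mult_mono) auto
  then have "B * (\<alpha> * B) \<le> B * (1 - B)" using params by (intro mult_left_mono) auto
  moreover have "\<alpha> * \<alpha> - \<alpha> * B = B * (\<alpha> * B)" by (simp add: \<alpha>_eq algebra_simps)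
  ultimately have **: "\<alpha> * \<alpha> - \<beta> \<le> (\<alpha> - \<beta>) * B"
    using \<open>\<beta> * (1 - B) \<ge> B * (1 - B)\<close> by (simp add: algebra_simps)
  have "(\<alpha> * \<alpha> - \<beta>) * n \<le> (\<alpha> - \<beta>) * (B * n)" using mult_right_mono[OF **, of n] n0 by simp
  also have "\<dots> \<le> (\<alpha> - \<beta>) * a" using B params by (intro mult_left_mono) auto
  finally have "\<alpha> * (\<alpha> * n - a) \<le> \<beta> * (n - a)" by (simp add: algebra_simps)
  moreover have "\<alpha> * c \<le> \<alpha> * (\<alpha> * n - a)" using m params by (intro mult_left_mono) auto
  ultimately show "\<alpha> * c \<le> \<beta> * (c + d)" unfolding cd by simp
  have "(\<alpha> - \<beta>) * n \<le> (1 - \<beta>) * (B * n)" using mult_right_mono[OF *, of n] n0 by simp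
  also have "\<dots> \<le> (1 - \<beta>) * a" using B params by (intro mult_left_mono) auto
  finally show "\<alpha> * d \<le> \<beta> * (c + d)" using d unfolding cd by (simp add: algebra_simps)
qed

text \<open>Equality holds at \<open>\<beta> = B\<close>, so the difference expands in
  \<open>t = \<beta> - B\<close> without constant term. The linear coefficient is nonnegative
  because \<open>B \<le> 1/2\<close>; it vanishes at \<open>B = 1/2\<close>, that is, at
  \<open>\<alpha> = 3/4\<close>.\<close>

lemma \<beta>_key: "\<beta> * (\<alpha> - \<beta>) \<le> B * (\<beta> * \<beta> * (1 - \<alpha>) + \<alpha> * (\<alpha> - \<beta>))"
proof -
  define t where "t = \<beta> - B"
  have t: "0 \<le> t" "\<beta> = B + t" using \<beta>_ge_B by (simp_all add: t_def)
  have "B * (\<beta> * \<beta> * (1 - \<alpha>) + \<alpha> * (\<alpha> - \<beta>)) - \<beta> * (\<alpha> - \<beta>)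
      = t * (B * (1 - 3 * (B * B) - 2 * (B * B) * B)) + t * t * (B * (1 - \<alpha>) + 1)"
    unfolding t(2) \<alpha>_eq by algebra
  moreover have "B * B * B \<le> 1/4 * (1/2)" using B_square_le(3) params by (intro mult_mono) auto
  then have "0 \<le> 1 - 3 * (B * B) - 2 * (B * B) * B" using B_square_le(3) by simp
  then have "0 \<le> t * (B * (1 - 3 * (B * B) - 2 * (B * B) * B))" using t B_pos by simp
  moreover have "0 \<le> t * t * (B * (1 - \<alpha>) + 1)" using params t by simp
  ultimately show ?thesis by linarith
qed

text \<open>With \<open>c = p + q\<close>, everything rests on \<open>c \<ge> B * n\<close> and on
  the lower bounds \<open>(1 - \<alpha>) * c\<close> for \<open>p\<close>, \<open>q\<close> and
  \<open>\<alpha> * a\<close>. Six conclusions concern the new root, four \<open>bal_C\<close> and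
  four \<open>bal_GC\<close> at its children. In the last one, \<open>x\<close> is the weight of a
  child of the node of weight \<open>p\<close>, bounded both by its parent and by its former
  grandparent.\<close>

lemma double_rot_weights:
  fixes a p q d n :: real
  assumes pos: "0 < a" "0 < p" "0 < q" "0 < d" and n: "n = a + (p + q) + d"
    and m: "a + (p + q) \<le> \<alpha> * n" and c: "p + q \<le> \<alpha> * (a + (p + q))"
    and p: "p \<le> \<alpha> * (p + q)" "p \<le> \<beta> * (a + (p + q))"
    and q: "q \<le> \<alpha> * (p + q)" "q \<le> \<beta> * (a + (p + q))"
    and B: "B * n \<le> p + q"
  shows "a + p \<le> \<alpha> * n" "q + d \<le> \<alpha> * n" "a \<le> \<beta> * n" "p \<le> \<beta> * n" "q \<le> \<beta> * n" "d \<le> \<beta> * n"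
    "a \<le> \<alpha> * (a + p)" "p \<le> \<alpha> * (a + p)" "q \<le> \<alpha> * (q + d)" "d \<le> \<alpha> * (q + d)"
    "\<alpha> * a \<le> \<beta> * (a + p)" "\<alpha> * q \<le> \<beta> * (q + d)" "\<alpha> * d \<le> \<beta> * (q + d)"
    "\<And>x. x \<le> \<alpha> * p \<Longrightarrow> x \<le> \<beta> * (p + q) \<Longrightarrow> x \<le> \<beta> * (a + p)"
proof -
  define c where "c = p + q"
  define m where "m = a + c"
  note m = m[folded c_def, folded m_def] and c = c[folded c_def, folded m_def]
    and p = p[folded c_def, folded m_def] and q = q[folded c_def, folded m_def]
    and B = B[folded c_def]
  have d: "d = n - m" using n by (simp add: m_def c_def)
  have n0: "0 < n" and c0: "0 < c" using pos n by (simp_all add: c_def)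
  have \<beta>n: "B * n \<le> \<beta> * n" using \<beta>_ge_B n0 by simp
  have p_ge: "(1 - \<alpha>) * c \<le> p" and q_ge: "(1 - \<alpha>) * c \<le> q"
    using p q by (simp_all add: c_def algebra_simps)
  have a_ge: "(1 - \<alpha>) * c \<le> \<alpha> * a" using c by (simp add: m_def algebra_simps)
  have c_ge: "\<alpha> * n \<le> (1 + \<alpha>) * c" "\<alpha> * n \<le> (1 + \<alpha> * \<alpha>) * c"
  proof -
    have "\<alpha> * n \<le> (1 + \<alpha>) * (B * n)" using mult_right_mono[OF \<alpha>_le_B(1), of n] n0 by (simp add: mult.assoc)
    also have "\<dots> \<le> (1 + \<alpha>) * c" using B params by (intro mult_left_mono) auto
    finally show "\<alpha> * n \<le> (1 + \<alpha>) * c" .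
    have "\<alpha> * n \<le> (1 + \<alpha> * \<alpha>) * (B * n)" using mult_right_mono[OF \<alpha>_le_B(2), of n] n0 by (simp add: mult.assoc)
    also have "\<dots> \<le> (1 + \<alpha> * \<alpha>) * c" using B params by (intro mult_left_mono) auto
    finally show "\<alpha> * n \<le> (1 + \<alpha> * \<alpha>) * c" .
  qed
  show "a + p \<le> \<alpha> * n" using m pos by (simp add: m_def c_def)
  have "(1 - \<alpha>) * (\<alpha> * n) \<le> (1 - \<alpha>) * ((1 + \<alpha>) * c)"
    using c_ge(1) params by (intro mult_left_mono) auto
  also have "\<dots> \<le> \<alpha> * (a + p)"
    using a_ge mult_left_mono[OF p_ge, of \<alpha>] params by (simp add: algebra_simps)
  finally have "\<alpha> * ((1 - \<alpha>) * n) \<le> \<alpha> * (a + p)" by (simp add: algebra_simps)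
  then have "(1 - \<alpha>) * n \<le> a + p" using params by simp
  then show "q + d \<le> \<alpha> * n" by (simp add: n algebra_simps)
  have a_le: "a \<le> (B * B) * n" using m B \<alpha>_eq by (simp add: m_def algebra_simps)
  also have "\<dots> \<le> B * n" using n0 params mult_left_le[of B B] by (intro mult_right_mono) auto
  finally show "a \<le> \<beta> * n" using \<beta>n by simp
  have "m \<le> n" using pos d by simp
  then have "\<beta> * m \<le> \<beta> * n" using params by (intro mult_left_mono) auto
  then show "p \<le> \<beta> * n" "q \<le> \<beta> * n" using p q by simp_all
  show "d \<le> \<beta> * n" using other_child_le[OF n0 B c] d by simp
  have "a \<le> \<alpha> * c" using c_ge(1) m by (simp add: m_def algebra_simps)
  then have "(1 - \<alpha>) * a \<le> (1 - \<alpha>) * (\<alpha> * c)" using params by (intro mult_left_mono) auto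
  also have "\<dots> \<le> \<alpha> * p" using mult_left_mono[OF p_ge, of \<alpha>] params by (simp add: algebra_simps)
  finally show "a \<le> \<alpha> * (a + p)" by (simp add: algebra_simps)
  have "(1 - \<alpha>) * p \<le> (1 - \<alpha>) * c" using params pos by (intro mult_left_mono) (auto simp: c_def)
  then show "p \<le> \<alpha> * (a + p)" using a_ge by (simp add: algebra_simps)
  have d_ge: "(1 - \<alpha>) * n \<le> d" using m d by (simp add: algebra_simps)
  have "\<beta> * m \<le> \<beta> * (\<alpha> * n)" using m params by (intro mult_left_mono) auto
  also have "\<dots> \<le> 1 * (\<alpha> * n)" using params n0 by (intro mult_right_mono) auto
  finally have q_le: "q \<le> \<alpha> * n" "q \<le> \<beta> * (\<alpha> * n)"
    using q \<open>\<beta> * m \<le> \<beta> * (\<alpha> * n)\<close> by simp_all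
  have "(1 - \<alpha>) * q \<le> (1 - \<alpha>) * (\<alpha> * n)" using q_le params by (intro mult_left_mono) auto
  also have "\<dots> \<le> \<alpha> * d" using mult_left_mono[OF d_ge, of \<alpha>] params by (simp add: algebra_simps)
  finally show "q \<le> \<alpha> * (q + d)" by (simp add: algebra_simps)
  have "\<alpha> * d \<le> \<alpha> * (\<alpha> * c)" unfolding d using c_ge(2) c by (simp add: algebra_simps)
  then have "d \<le> \<alpha> * c" using params by simp
  then have "(1 - \<alpha>) * d \<le> (1 - \<alpha>) * (\<alpha> * c)" using params by (intro mult_left_mono) auto
  also have "\<dots> \<le> \<alpha> * q" using mult_left_mono[OF q_ge, of \<alpha>] params by (simp add: algebra_simps)
  finally show "d \<le> \<alpha> * (q + d)" by (simp add: algebra_simps)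
  have \<alpha>\<beta>: "0 \<le> \<alpha> - \<beta>" "\<alpha> - \<beta> \<le> B * B" using params \<alpha>_eq by simp_all
  have \<beta>0: "0 < \<beta>" using params by simp
  have "(\<alpha> - \<beta>) * a \<le> (B * B) * ((B * B) * n)"
    using \<alpha>\<beta> a_le pos by (intro mult_mono) auto
  also have "\<dots> \<le> (1 - \<alpha>) * ((B * B) * n)"
    using B_square_le(1) n0 by (intro mult_right_mono) auto
  also have "\<dots> \<le> (1 - \<alpha>) * (\<beta> * c)"
    using params B mult_mono[OF \<beta>_ge_B B] n0 by (intro mult_left_mono) (auto simp: mult.assoc)
  also have "\<dots> \<le> \<beta> * p" using mult_left_mono[OF p_ge, of \<beta>] \<beta>0 by (simp add: algebra_simps)
  finally show "\<alpha> * a \<le> \<beta> * (a + p)" by (simp add: algebra_simps)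
  have "(\<alpha> - \<beta>) * q \<le> (B * B) * (\<beta> * (\<alpha> * n))"
    using \<alpha>\<beta> q_le pos by (intro mult_mono) auto
  also have "\<dots> \<le> (1 - \<alpha>) * (\<beta> * (1 * n))"
    using B_square_le(1) n0 \<beta>0 params by (intro mult_mono mult_left_mono mult_right_mono) auto
  also have "\<dots> \<le> \<beta> * d" using mult_left_mono[OF d_ge, of \<beta>] \<beta>0 by (simp add: algebra_simps)
  finally show "\<alpha> * q \<le> \<beta> * (q + d)" by (simp add: algebra_simps)
  show "\<alpha> * d \<le> \<beta> * (q + d)"
  proof -
    \<comment> \<open>Combine both lower bounds on \<open>q\<close>, with weights that cancel \<open>m\<close>.\<close>
    have q_ge': "c - \<beta> * m \<le> q" using p by (simp add: c_def)
    have "0 \<le> \<beta> * \<beta> - (\<alpha> - \<beta>)"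
      using \<alpha>\<beta> mult_mono[OF \<beta>_ge_B \<beta>_ge_B] params by linarith
    then have "(\<beta> * \<beta> - (\<alpha> - \<beta>)) * ((1 - \<alpha>) * c) + (\<alpha> - \<beta>) * (c - \<beta> * m)
        \<le> (\<beta> * \<beta> - (\<alpha> - \<beta>)) * q + (\<alpha> - \<beta>) * q"
      using q_ge q_ge' \<alpha>\<beta>(1) by (intro add_mono mult_left_mono)
    moreover have "\<beta> * (\<alpha> - \<beta>) * n \<le> (\<beta> * \<beta> * (1 - \<alpha>) + \<alpha> * (\<alpha> - \<beta>)) * c"
    proof -
      have "\<beta> * (\<alpha> - \<beta>) * n \<le> (\<beta> * \<beta> * (1 - \<alpha>) + \<alpha> * (\<alpha> - \<beta>)) * (B * n)"
        using mult_right_mono[OF \<beta>_key, of n] n0 by (simp add: algebra_simps)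
      also have "\<dots> \<le> (\<beta> * \<beta> * (1 - \<alpha>) + \<alpha> * (\<alpha> - \<beta>)) * c"
        using B \<alpha>\<beta> params by (intro mult_left_mono) auto
      finally show ?thesis .
    qed
    ultimately have "\<beta> * ((\<alpha> - \<beta>) * d) \<le> \<beta> * (\<beta> * q)"
      unfolding d by (simp add: algebra_simps)
    then have "(\<alpha> - \<beta>) * d \<le> \<beta> * q" using \<beta>0 by simp
    then show ?thesis by (simp add: algebra_simps)
  qed
  fix x assume x: "x \<le> \<alpha> * p" "x \<le> \<beta> * (p + q)"
  show "x \<le> \<beta> * (a + p)"
  \<comment> \<open>In the first case \<open>a + p \<ge> c\<close>, so the bound from the former
    grandparent suffices. Otherwise \<open>p\<close> is so small compared with \<open>a\<close> that
    the bound from the parent does.\<close>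
  proof (cases "(2 * \<alpha> - 1) * c \<le> \<alpha> * p")
    case True
    then have "\<alpha> * c \<le> \<alpha> * (a + p)" using a_ge by (simp add: algebra_simps)
    then have "\<beta> * c \<le> \<beta> * (a + p)" using params by simp
    then show ?thesis using x(2) by (simp add: c_def)
  next
    case False
    have "\<alpha> * ((\<alpha> - \<beta>) * p) = (\<alpha> - \<beta>) * (\<alpha> * p)" by simp
    also have "\<dots> \<le> (\<alpha> - \<beta>) * ((2 * \<alpha> - 1) * c)" using False \<alpha>\<beta> by (intro mult_left_mono) auto
    also have "\<dots> \<le> \<beta> * (1 - \<alpha>) * c"
    proof -
      have "\<alpha> * (2 * \<alpha> - 1) \<le> \<alpha> * \<beta>" using two_\<alpha> params by (intro mult_left_mono) auto
      then have "(\<alpha> - \<beta>) * (2 * \<alpha> - 1) \<le> \<beta> * (1 - \<alpha>)" by (simp add: algebra_simps)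
      from mult_right_mono[OF this, of c] show ?thesis using c0 by simp
    qed
    also have "\<dots> \<le> \<alpha> * (\<beta> * a)" using mult_left_mono[OF a_ge, of \<beta>] \<beta>0 by (simp add: algebra_simps)
    finally have "(\<alpha> - \<beta>) * p \<le> \<beta> * a" using params by simp
    then show ?thesis using x(1) by (simp add: algebra_simps)
  qed
qed

section \<open>Bounds on the derived thresholds\<close>

lemma alpha_hat_le: "alpha_hat \<alpha> \<le> \<alpha>"
proof -
  \<comment> \<open>Clearing the positive denominator and squaring reduces the claim to this
    product; its zero at \<open>\<alpha> = 1 / sqrt 2\<close> is a case of equality.\<close>
  have "0 \<le> (2 * \<alpha> - 1) * (2 * \<alpha>\<^sup>2 - 1)" using \<alpha>_square params by (intro mult_nonneg_nonneg) auto
  then have "((1 - \<alpha>) * (1 + 4 * \<alpha>)\<^sup>2) \<le> 5 - \<alpha>"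
    by (simp add: power2_eq_square algebra_simps)
  then have "(1 - \<alpha>) * ((1 - \<alpha>) * (1 + 4 * \<alpha>)\<^sup>2) \<le> (1 - \<alpha>) * (5 - \<alpha>)"
    using params by (intro mult_left_mono) auto
  then have "((1 - \<alpha>) * (1 + 4 * \<alpha>))\<^sup>2 \<le> (1 - \<alpha>) * (5 - \<alpha>)"
    by (simp add: power2_eq_square mult_ac)
  then have "(1 - \<alpha>) * (1 + 4 * \<alpha>) \<le> sqrt ((1 - \<alpha>) * (5 - \<alpha>))" by (rule real_le_rsqrt)
  then have "1 - 2 * \<alpha> + 6 * \<alpha>\<^sup>2 - sqrt ((1 - \<alpha>) * (5 - \<alpha>)) \<le> \<alpha> * (5 * (2 * \<alpha> - 1))"
    by (simp add: power2_eq_square algebra_simps)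
  then show ?thesis unfolding alpha_hat_def using params by (intro mult_imp_div_pos_le) auto
qed

text \<open>Cleared of its denominator, the claim reads \<open>(1 + \<alpha>) * s \<le> P\<close>.
  The difference of the squares again contains the factor \<open>2 * \<alpha>\<^sup>2 - 1\<close>,
  and the other factors are nonnegative.\<close>

lemma alpha_hat_ge: "(1 + \<alpha>) * (1 - alpha_hat \<alpha>) \<le> \<alpha> * \<alpha>"
proof -
  define P where "P = 16 * \<alpha>^3 - 11 * \<alpha>^2 - 6 * \<alpha> + 6"
  define s where "s = sqrt ((1 - \<alpha>) * (5 - \<alpha>))"
  have "0 \<le> (1 - \<alpha>) * (5 - \<alpha>)" using params by simp
  then have s: "0 \<le> s" "s\<^sup>2 = (1 - \<alpha>) * (5 - \<alpha>)" by (simp_all add: s_def)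
  have "0 \<le> \<alpha>\<^sup>2 * (16 * \<alpha> - 11)" using params by (intro mult_nonneg_nonneg) auto
  moreover have "P = \<alpha>\<^sup>2 * (16 * \<alpha> - 11) + 6 * (1 - \<alpha>)" unfolding P_def by algebra
  ultimately have "0 \<le> P" using params by simp
  \<comment> \<open>The cubic below is \<open>31 - 14 * \<alpha> - 8 * \<alpha>\<^sup>2 * (7 - 8 *
    \<alpha>)\<close>; replacing \<open>\<alpha>\<^sup>2\<close> by 1 leaves
    \<open>25 * (2 * \<alpha> - 1)\<close>.\<close>
  have "\<alpha>\<^sup>2 * (7 - 8 * \<alpha>) \<le> 1 * (7 - 8 * \<alpha>)"
    using params by (intro mult_right_mono) (auto simp: power2_eq_square)
  then have "0 \<le> 64 * \<alpha>^3 - 56 * \<alpha>^2 - 14 * \<alpha> + 31"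
    using params by (simp add: power2_eq_square power3_eq_cube algebra_simps)
  then have "0 \<le> (2 * \<alpha>\<^sup>2 - 1) * ((2 * \<alpha> - 1) * (64 * \<alpha>^3 - 56 * \<alpha>^2 - 14 * \<alpha> + 31))"
    using params \<alpha>_square by (intro mult_nonneg_nonneg) auto
  also have "\<dots> = P\<^sup>2 - (1 + \<alpha>)\<^sup>2 * ((1 - \<alpha>) * (5 - \<alpha>))" unfolding P_def by algebra
  finally have "((1 + \<alpha>) * s)\<^sup>2 \<le> P\<^sup>2" by (simp add: power_mult_distrib s)
  then have sP: "(1 + \<alpha>) * s \<le> P" using \<open>0 \<le> P\<close> by (rule power2_le_imp_le)
  have "alpha_hat \<alpha> * (5 * (2 * \<alpha> - 1)) = 1 - 2 * \<alpha> + 6 * \<alpha>\<^sup>2 - s"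
    using params by (simp add: alpha_hat_def s_def)
  then have "(1 + \<alpha>) * (alpha_hat \<alpha> * (5 * (2 * \<alpha> - 1))) = (1 + \<alpha>) * (1 - 2 * \<alpha> + 6 * \<alpha>\<^sup>2) - (1 + \<alpha>) * s"
    by (simp only: right_diff_distrib)
  also have "\<dots> \<ge> (1 + \<alpha>) * (1 - 2 * \<alpha> + 6 * \<alpha>\<^sup>2) - P" using sP by simp
  also have "(1 + \<alpha>) * (1 - 2 * \<alpha> + 6 * \<alpha>\<^sup>2) - P = (1 + \<alpha> - \<alpha> * \<alpha>) * (5 * (2 * \<alpha> - 1))"
    unfolding P_def by algebra
  finally have "(1 + \<alpha> - \<alpha> * \<alpha>) * (5 * (2 * \<alpha> - 1)) \<le> ((1 + \<alpha>) * alpha_hat \<alpha>) * (5 * (2 * \<alpha> - 1))"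
    by (simp add: mult.assoc)
  then have "1 + \<alpha> - \<alpha> * \<alpha> \<le> (1 + \<alpha>) * alpha_hat \<alpha>"
    using params by (subst (asm) mult_le_cancel_right_pos) auto
  then show ?thesis by (simp add: algebra_simps)
qed

text \<open>\<open>beta_hat\<close> solves a quadratic equation. The quadratic is
  \<open>(\<beta> - B) * (B * B) \<ge> 0\<close> at \<open>B\<close>, which lies left of the vertex,
  and at most 0 at \<beta>, because \<open>\<alpha> \<le> \<beta> + \<beta> * \<beta>\<close>. So
  the smaller root lies between \<open>B\<close> and \<beta>.\<close>

lemma beta_hat_bounds:
  shows "B \<le> beta_hat \<alpha> \<beta>" "beta_hat \<alpha> \<beta> \<le> \<beta>"
proof -
  define D where "D = 1 - \<alpha>\<^sup>2 + \<beta>"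
  define s where "s = sqrt ((1 - \<alpha>)\<^sup>2 + 4 * \<alpha> * (\<alpha>\<^sup>2 - \<beta>))"
  have D: "0 < D" using params by (simp add: D_def power2_eq_square)
  have "0 \<le> 4 * \<alpha> * (\<alpha>\<^sup>2 - \<beta>)" using params by (simp add: power2_eq_square)
  then have s: "0 \<le> s" "s\<^sup>2 = (1 - \<alpha>)\<^sup>2 + 4 * \<alpha> * (\<alpha>\<^sup>2 - \<beta>)" by (simp_all add: s_def)
  have bh: "beta_hat \<alpha> \<beta> = (1 + \<alpha> - s) * \<alpha> / (2 * D)" by (simp add: beta_hat_def s_def D_def)
  \<comment> \<open>\<open>beta_hat\<close> is the smaller root of the convex quadratic
    \<open>(\<alpha>\<^sup>2 - b) (\<alpha> - b) - (\<alpha>\<^sup>2 - \<beta>) b\<^sup>2\<close>.\<close>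
  have root: "((1 + \<alpha>) * \<alpha> - 2 * D * b)\<^sup>2 - (s * \<alpha>)\<^sup>2
      = 4 * D * ((\<alpha>\<^sup>2 - b) * (\<alpha> - b) - (\<alpha>\<^sup>2 - \<beta>) * b\<^sup>2)" for b
    unfolding power_mult_distrib s D_def by algebra
  have "(\<alpha>\<^sup>2 - B) * (\<alpha> - B) - (\<alpha>\<^sup>2 - \<beta>) * B\<^sup>2 = (\<beta> - B) * (B * B)"
    by (simp add: \<alpha>_eq power2_eq_square algebra_simps)
  then have "((1 + \<alpha>) * \<alpha> - 2 * D * B)\<^sup>2 - (s * \<alpha>)\<^sup>2 \<ge> 0"
    unfolding root using D params by simp
  then have "(s * \<alpha>)\<^sup>2 \<le> ((1 + \<alpha>) * \<alpha> - 2 * D * B)\<^sup>2" by linarith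
  moreover have "0 \<le> (1 + \<alpha>) * \<alpha> - 2 * D * B"
  proof -
    have "D * B \<le> 1 * B" using params by (intro mult_right_mono) (auto simp: D_def power2_eq_square)
    moreover have "2 * B \<le> (1 + \<alpha>) * \<alpha>"
      using \<alpha>_square params by (simp add: power2_eq_square algebra_simps)
    ultimately show ?thesis by simp
  qed
  ultimately have "s * \<alpha> \<le> (1 + \<alpha>) * \<alpha> - 2 * D * B" by (rule power2_le_imp_le)
  then have "B * (2 * D) \<le> (1 + \<alpha> - s) * \<alpha>" by (simp add: algebra_simps)
  then show "B \<le> beta_hat \<alpha> \<beta>" unfolding bh using D by (simp add: le_divide_eq)
  have "B * B \<le> \<beta> * \<beta>" using params by (intro mult_mono) auto
  then have "\<alpha> - \<beta> - \<beta> * \<beta> \<le> 0" using params \<alpha>_eq by linarith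
  then have "(\<alpha>\<^sup>2 - \<beta>) * (\<alpha> - \<beta> - \<beta> * \<beta>) \<le> 0"
    using params by (intro mult_nonneg_nonpos) (auto simp: power2_eq_square)
  then have "(\<alpha>\<^sup>2 - \<beta>) * (\<alpha> - \<beta>) - (\<alpha>\<^sup>2 - \<beta>) * \<beta>\<^sup>2 \<le> 0"
    by (simp add: power2_eq_square algebra_simps)
  then have "((1 + \<alpha>) * \<alpha> - 2 * D * \<beta>)\<^sup>2 - (s * \<alpha>)\<^sup>2 \<le> 0"
    unfolding root using D by (intro mult_nonneg_nonpos) auto
  then have "((1 + \<alpha>) * \<alpha> - 2 * D * \<beta>)\<^sup>2 \<le> (s * \<alpha>)\<^sup>2" by linarith
  then have "(1 + \<alpha>) * \<alpha> - 2 * D * \<beta> \<le> s * \<alpha>"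
    by (rule power2_le_imp_le) (use s(1) \<alpha>_pos in simp)
  then have "(1 + \<alpha> - s) * \<alpha> \<le> \<beta> * (2 * D)" by (simp add: algebra_simps)
  then show "beta_hat \<alpha> \<beta> \<le> \<beta>" unfolding bh using D by (simp add: divide_le_eq)
qed

section \<open>Weights under the rotations of C-balancing\<close>

lemma C_simple_rot_weights:
  fixes a c d n :: real
  assumes pos: "0 < a" "0 < c" "0 < d" and n: "n = a + c + d"
    and m: "\<alpha> * n < a + c" "a + c \<le> 13/12 * \<alpha> * n" and a: "a \<le> \<alpha> * (a + c)"
    and h: "(1 - alpha_hat \<alpha>) * n \<le> a"
  shows "a \<le> \<alpha> * n" "c + d \<le> \<alpha> * n" "c \<le> \<alpha> * (c + d)" "d \<le> \<alpha> * (c + d)"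
proof -
  define m where "m = a + c"
  note m = m[folded m_def] and a = a[folded m_def]
  have n0: "0 < n" using pos n by simp
  have "13/12 * \<alpha> * n \<le> n" using params n0 by simp
  then have "m \<le> n" using m by simp
  then have "\<alpha> * m \<le> \<alpha> * n" using params by simp
  then show "a \<le> \<alpha> * n" using a by simp
  have "(1 - \<alpha>) * n \<le> (1 - alpha_hat \<alpha>) * n" using alpha_hat_le n0 by (intro mult_right_mono) auto
  then have a_ge: "(1 - \<alpha>) * n \<le> a" using h by simp
  then show "c + d \<le> \<alpha> * n" by (simp add: n algebra_simps)
  have cd: "c + d = n - a" using n by simp
  \<comment> \<open>In the limit \<open>\<alpha> = 3/4\<close> both sides of the next inequality
    become 1/16, so the factor 13/12 is just small enough.\<close>
  have "1/4 * (1/4) \<le> (1 - \<alpha>) * (1 - \<alpha>)" using params by (intro mult_mono) auto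
  then have "13/12 * \<alpha> - \<alpha> \<le> (1 - \<alpha>) * (1 - \<alpha>)" using params by simp
  from mult_right_mono[OF this, of n] have "13/12 * \<alpha> * n - \<alpha> * n \<le> (1 - \<alpha>) * ((1 - \<alpha>) * n)"
    using n0 by (simp add: algebra_simps)
  also have "\<dots> \<le> (1 - \<alpha>) * a" using a_ge params by (intro mult_left_mono) auto
  finally show "c \<le> \<alpha> * (c + d)" using m unfolding cd by (simp add: m_def algebra_simps)
  have "1 \<le> (1 + \<alpha>) * \<alpha>" using \<alpha>_square params by (simp add: power2_eq_square algebra_simps)
  from mult_right_mono[OF this, of n] have "n \<le> (1 + \<alpha>) * (\<alpha> * n)" using n0 by (simp add: mult.assoc)
  also have "\<dots> \<le> (1 + \<alpha>) * m" using m params by (intro mult_left_mono) auto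
  finally have "(1 - \<alpha>) * n \<le> (1 - \<alpha>) * ((1 + \<alpha>) * m)" using params by (intro mult_left_mono) auto
  moreover have "\<alpha> * a \<le> \<alpha> * (\<alpha> * m)" using a params by (intro mult_left_mono) auto
  ultimately show "d \<le> \<alpha> * (c + d)" unfolding cd using n by (simp add: m_def algebra_simps)
qed

text \<open>Through \<open>alpha_hat_ge\<close>, the hypothesis \<open>h\<close> caps
  \<open>a\<close>: \<open>(1 + \<alpha>) * a \<le> \<alpha> * (\<alpha> * n)\<close>. Hence
  \<open>p + q\<close> is large enough for its two parts to balance \<open>a\<close> and
  \<open>d\<close>.\<close>

lemma C_double_rot_weights:
  fixes a p q d n :: real
  assumes pos: "0 < a" "0 < p" "0 < q" "0 < d" and n: "n = a + (p + q) + d"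
    and m: "\<alpha> * n < a + (p + q)" "a + (p + q) \<le> 13/12 * \<alpha> * n"
    and c: "p + q \<le> \<alpha> * (a + (p + q))" and p: "p \<le> \<alpha> * (p + q)" and q: "q \<le> \<alpha> * (p + q)"
    and h: "a < (1 - alpha_hat \<alpha>) * n"
  shows "a + p \<le> \<alpha> * n" "q + d \<le> \<alpha> * n"
    "a \<le> \<alpha> * (a + p)" "p \<le> \<alpha> * (a + p)" "q \<le> \<alpha> * (q + d)" "d \<le> \<alpha> * (q + d)"
proof -
  define c where "c = p + q"
  define m where "m = a + c"
  note m = m[folded c_def, folded m_def] and c = c[folded c_def, folded m_def]
    and p = p[folded c_def] and q = q[folded c_def]
  have d: "d = n - m" using n by (simp add: m_def c_def)
  have n0: "0 < n" using pos n by simp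
  have p_ge: "(1 - \<alpha>) * c \<le> p" and q_ge: "(1 - \<alpha>) * c \<le> q"
    using p q by (simp_all add: c_def algebra_simps)
  have a_ge: "(1 - \<alpha>) * c \<le> \<alpha> * a" "(1 - \<alpha>) * m \<le> a" using c by (simp_all add: m_def algebra_simps)
  have \<alpha>2: "1 \<le> (1 + \<alpha>) * \<alpha>" using \<alpha>_square params by (simp add: power2_eq_square algebra_simps)
  have "(1 + \<alpha>) * a \<le> (1 + \<alpha>) * (1 - alpha_hat \<alpha>) * n"
    using h params by (simp add: mult.assoc)
  also have "\<dots> \<le> \<alpha> * (\<alpha> * n)" using mult_right_mono[OF alpha_hat_ge, of n] n0 by (simp add: mult.assoc)
  finally have a_le: "(1 + \<alpha>) * a \<le> \<alpha> * (\<alpha> * n)" .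
  also have "\<dots> \<le> \<alpha> * m" using m params by (intro mult_left_mono) auto
  finally have a_le_c: "a \<le> \<alpha> * c" by (simp add: m_def algebra_simps)
  \<comment> \<open>Since \<open>p \<le> \<alpha> * c\<close>, the target is
    \<open>\<alpha> * m + (1 - \<alpha>) * a \<le> \<alpha> * n\<close>. The constants 17/10 and
    3/10 come from \<open>7/10 < \<alpha>\<close>, and 3/17 is their quotient.\<close>
  have "\<alpha> * m \<le> \<alpha> * (13/12 * \<alpha> * n)" using m params by (intro mult_left_mono) auto
  also have "\<dots> = 13/12 * (\<alpha> * (\<alpha> * n))" by simp
  finally have "\<alpha> * m \<le> 13/12 * (\<alpha> * (\<alpha> * n))" .
  moreover have "17/10 * a \<le> (1 + \<alpha>) * a" "(1 - \<alpha>) * a \<le> 3/10 * a"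
    using params pos by (auto intro!: mult_right_mono)
  then have "(1 - \<alpha>) * a \<le> 3/17 * (\<alpha> * (\<alpha> * n))" using a_le by linarith
  moreover have "13/12 * (\<alpha> * (\<alpha> * n)) + 3/17 * (\<alpha> * (\<alpha> * n)) \<le> \<alpha> * n"
  proof -
    have "(13/12 + 3/17) * \<alpha> \<le> 1" using params by simp
    from mult_right_mono[OF this, of "\<alpha> * n"] show ?thesis using params n0 by (simp add: algebra_simps)
  qed
  ultimately have "\<alpha> * m + (1 - \<alpha>) * a \<le> \<alpha> * n" by linarith
  then show "a + p \<le> \<alpha> * n" using q_ge by (simp add: m_def c_def algebra_simps)
  have "(1 - \<alpha>) * n \<le> (1 - \<alpha>) * ((1 + \<alpha>) * \<alpha> * n)"
    using mult_right_mono[OF \<alpha>2, of n] n0 params by (intro mult_left_mono) auto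
  also have "\<dots> \<le> (1 - \<alpha>) * ((1 + \<alpha>) * m)"
    using m params unfolding mult.assoc by (intro mult_left_mono) auto
  also have "\<dots> \<le> a + p" using mult_left_mono[OF a_ge(2), of \<alpha>] p_ge params
    by (simp add: m_def algebra_simps)
  finally show "q + d \<le> \<alpha> * n" by (simp add: n algebra_simps)
  have "(1 - \<alpha>) * a \<le> (1 - \<alpha>) * (\<alpha> * c)" using a_le_c params by (intro mult_left_mono) auto
  also have "\<dots> \<le> \<alpha> * p" using mult_left_mono[OF p_ge, of \<alpha>] params by (simp add: algebra_simps)
  finally show "a \<le> \<alpha> * (a + p)" by (simp add: algebra_simps)
  have "(1 - \<alpha>) * p \<le> (1 - \<alpha>) * c" using params pos by (intro mult_left_mono) (auto simp: c_def)
  then show "p \<le> \<alpha> * (a + p)" using a_ge by (simp add: algebra_simps)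
  \<comment> \<open>The target is \<open>(1 - \<alpha>) * (\<alpha> * m) \<le> n - m\<close>, hence
    the factor \<open>1 + \<alpha> * (1 - \<alpha>)\<close>, bounded by \<open>1 + 9/40\<close>. The
    final numeric margin is below 1/200.\<close>
  have "\<alpha> * (1 - \<alpha>) \<le> 3/4 * (3/10)" using params by (intro mult_mono) auto
  then have "13/12 * \<alpha> * (1 + \<alpha> * (1 - \<alpha>)) \<le> 13/12 * (3/4) * (1 + 9/40)"
    using params by (intro mult_mono) auto
  then have "13/12 * \<alpha> * (1 + \<alpha> * (1 - \<alpha>)) \<le> 1" by simp
  from mult_right_mono[OF this, of n] have "(1 + \<alpha> * (1 - \<alpha>)) * (13/12 * \<alpha> * n) \<le> n"
    using n0 by (simp add: mult_ac)
  moreover have "(1 + \<alpha> * (1 - \<alpha>)) * m \<le> (1 + \<alpha> * (1 - \<alpha>)) * (13/12 * \<alpha> * n)"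
    using m params by (intro mult_left_mono) auto
  ultimately have "(1 - \<alpha>) * (\<alpha> * m) \<le> d" unfolding d by (simp add: algebra_simps)
  moreover have "(1 - \<alpha>) * c \<le> (1 - \<alpha>) * (\<alpha> * m)" using c params by (intro mult_left_mono) auto
  ultimately have "(1 - \<alpha>) * c \<le> d" by linarith
  then have "\<alpha> * ((1 - \<alpha>) * c) \<le> \<alpha> * d" using params by (intro mult_left_mono) auto
  moreover have "(1 - \<alpha>) * q \<le> (1 - \<alpha>) * (\<alpha> * c)" using q params by (intro mult_left_mono) auto
  ultimately show "q \<le> \<alpha> * (q + d)" by (simp add: algebra_simps)
  have "\<alpha> * ((1 + \<alpha>) * a) \<le> \<alpha> * (\<alpha> * (\<alpha> * n))" using a_le params by (intro mult_left_mono) auto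
  \<comment> \<open>Divided by \<open>n\<close> and expanded, the cubes cancel and exactly
    \<open>1 \<le> 2 * \<alpha>\<^sup>2\<close> remains.\<close>
  moreover have "(1 + \<alpha>) * n \<le> (1 + \<alpha>) * ((1 + \<alpha>) * \<alpha> * n) - \<alpha> * (\<alpha> * (\<alpha> * n))"
  proof -
    have "(1 + \<alpha>) * 1 \<le> (1 + \<alpha>) * (2 * \<alpha>\<^sup>2)" using \<alpha>_square params by (intro mult_left_mono) auto
    moreover have "2 * \<alpha>\<^sup>2 * \<alpha> \<le> 2 * \<alpha>\<^sup>2 * 1" using params by (intro mult_left_mono) auto
    ultimately have "1 + \<alpha> \<le> (1 + \<alpha>) * ((1 + \<alpha>) * \<alpha>) - \<alpha> * (\<alpha> * \<alpha>)"
      using \<alpha>_square params by (simp add: power2_eq_square algebra_simps)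
    from mult_right_mono[OF this, of n] show ?thesis using n0 by (simp add: algebra_simps)
  qed
  moreover have "(1 + \<alpha>) * ((1 + \<alpha>) * (\<alpha> * n)) \<le> (1 + \<alpha>) * ((1 + \<alpha>) * m)"
    using m params by (intro mult_left_mono) auto
  ultimately have "(1 + \<alpha>) * (n + \<alpha> * a) \<le> (1 + \<alpha>) * ((1 + \<alpha>) * m)"
    by (simp add: algebra_simps)
  then have "n + \<alpha> * a \<le> (1 + \<alpha>) * m" using params by simp
  then have "d \<le> \<alpha> * c" by (simp add: d m_def algebra_simps)
  then have "(1 - \<alpha>) * d \<le> (1 - \<alpha>) * (\<alpha> * c)" using params by (intro mult_left_mono) auto
  also have "\<dots> \<le> \<alpha> * q" using mult_left_mono[OF q_ge, of \<alpha>] params by (simp add: algebra_simps)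
  finally show "d \<le> \<alpha> * (q + d)" by (simp add: algebra_simps)
qed

end


section \<open>Balancing trees\<close>

lemma all_dir: "(\<forall>d. P d) \<longleftrightarrow> P L \<and> P R"
  by (metis dir.exhaust)

lemma balanced_iff_weight:
  "balanced x y t \<longleftrightarrow>
    (\<forall>d. weight t [d] \<le> x * real (size1 t)) \<and> (\<forall>d e. weight t [d, e] \<le> y * real (size1 t))"
  unfolding balanced_def bal_C_def bal_GC_def all_dir
  by (simp add: divide_le_eq)

lemma balanced_Node:
  "balanced x y \<langle>l, a, r\<rangle> \<longleftrightarrow>
    (let n = real (size1 l) + real (size1 r) in
      real (size1 l) \<le> x * n \<and> real (size1 r) \<le> x * n \<and>
      (\<forall>d. weight l [d] \<le> y * n) \<and> (\<forall>d. weight r [d] \<le> y * n))"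
  unfolding balanced_iff_weight Let_def by (simp add: all_dir)

text \<open>Unlike in \<open>GCB\<close>, empty trees are included, so that weight bounds are
  available for every sub-tree without case distinction; \<open>GCB_iff\<close> relates the two
  notions.\<close>

definition all_balanced :: "real \<Rightarrow> real \<Rightarrow> 'a tree \<Rightarrow> bool" where
  "all_balanced x y t \<longleftrightarrow> (\<forall>s\<in>subtrees t. balanced x y s)"

text \<open>The state in which GC-balancing starts: only \<open>bal_GC\<close> at the root is
  unconstrained.\<close>

definition almost_balanced :: "real \<Rightarrow> real \<Rightarrow> 'a tree \<Rightarrow> bool" where
  "almost_balanced x y t \<longleftrightarrow>
    (\<forall>d. weight t [d] \<le> x * real (size1 t)) \<and> all_balanced x y (left t) \<and> all_balanced x y (right t)"

lemma all_balanced_Node: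
  "all_balanced x y \<langle>l, a, r\<rangle> \<longleftrightarrow>
    balanced x y \<langle>l, a, r\<rangle> \<and> all_balanced x y l \<and> all_balanced x y r"
  unfolding all_balanced_def by auto

lemma all_balanced_imp_balanced: "all_balanced x y t \<Longrightarrow> balanced x y t"
  unfolding all_balanced_def by (cases t) auto

lemma all_balanced_weight:
  assumes "all_balanced x y t"
  shows "weight t [d] \<le> x * real (size1 t)" "weight t [d, e] \<le> y * real (size1 t)"
  using all_balanced_imp_balanced[OF assms] unfolding balanced_iff_weight by auto

lemma all_balanced_imp_almost: "all_balanced x y t \<Longrightarrow> almost_balanced x y t"
  unfolding almost_balanced_def using all_balanced_weight[of x y t]
  by (cases t) (auto simp: all_balanced_Node)

section \<open>Reflection and in-order sequences\<close>

fun flip :: "dir \<Rightarrow> dir" where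
  "flip L = R"
| "flip R = L"

text \<open>Reflection makes it enough to analyse the left-handed rotations.\<close>

lemma weight_mirror: "weight (mirror t) ds = weight t (map flip ds)"
proof (induction t arbitrary: ds)
  case Leaf
  then show ?case by (cases ds) auto
next
  case (Node l a r)
  then show ?case
  proof (cases ds)
    case (Cons d ds')
    then show ?thesis using Node by (cases d) auto
  qed simp
qed

lemma balanced_mirror [simp]: "balanced x y (mirror t) = balanced x y t"
  unfolding balanced_iff_weight weight_mirror all_dir by auto

lemma all_balanced_mirror [simp]: "all_balanced x y (mirror t) = all_balanced x y t"
proof (induction t)
  case (Node l a r)
  then show ?case using balanced_mirror[of x y "\<langle>l, a, r\<rangle>"] by (auto simp: all_balanced_Node)
qed simp

lemma left_mirror [simp]: "left (mirror t) = mirror (right t)"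
  and right_mirror [simp]: "right (mirror t) = mirror (left t)"
  by (cases t; simp)+

lemma almost_balanced_mirror [simp]: "almost_balanced x y (mirror t) = almost_balanced x y t"
  unfolding almost_balanced_def weight_mirror all_dir by auto

lemma simple_rot_mirror_eq: "simple_rot_mirror t = mirror (simple_rot (mirror t))"
  by (cases t rule: simple_rot_mirror.cases) auto

lemma double_rot_mirror_eq: "double_rot_mirror t = mirror (double_rot (mirror t))"
  by (cases t rule: double_rot_mirror.cases) auto

text \<open>The in-order sequence determines both the size and the search-tree property, so its
  invariance settles both.\<close>

lemma inorder_rot [simp]:
  "inorder (simple_rot t) = inorder t" "inorder (simple_rot_mirror t) = inorder t"
  "inorder (double_rot t) = inorder t" "inorder (double_rot_mirror t) = inorder t"
  subgoal by (cases t rule: simple_rot.cases) auto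
  subgoal by (cases t rule: simple_rot_mirror.cases) auto
  subgoal by (cases t rule: double_rot.cases) auto
  subgoal by (cases t rule: double_rot_mirror.cases) auto
  done

lemma inorder_C_balance [simp]: "inorder (C_balance u v w x t) = inorder t"
  by (simp add: C_balance_def Let_def)

lemma inorder_GC_balance [simp]: "inorder (GC_balance y z t) = inorder t"
  by (simp add: GC_balance_def Let_def)

lemma inorder_map_children:
  "(\<And>t. inorder (f t) = inorder t) \<Longrightarrow> inorder (map_children f t) = inorder t"
  by (cases t) auto

lemma inorder_CGC_balance [simp]: "inorder (CGC_balance u v y y' t) = inorder t"
  by (simp add: CGC_balance_def Let_def inorder_map_children)

lemma size_eq_if_inorder_eq: "inorder s = inorder t \<Longrightarrow> size s = size t"
  by (metis length_inorder)

lemma size1_GC_balance [simp]: "size1 (GC_balance y z t) = size1 t"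
  using size_eq_if_inorder_eq[OF inorder_GC_balance] by (simp add: size1_size)

section \<open>GC-balancing restores balance\<close>

context gcb_parameters
begin

abbreviation "all_bal \<equiv> all_balanced \<alpha> \<beta>"
abbreviation "almost_bal \<equiv> almost_balanced \<alpha> \<beta>"

lemma all_bal_Leaf [simp]: "all_bal \<langle>\<rangle>"
  using params by (simp add: all_balanced_def balanced_iff_weight all_dir)

lemma all_bal_simple_rot:
  assumes t: "almost_bal t" and B: "B * real (size1 t) \<le> weight t [L, L]"
  shows "all_bal (simple_rot t)"
proof -
  have "\<exists>t11 k1 t12 k t2. t = \<langle>\<langle>t11, k1, t12\<rangle>, k, t2\<rangle>"
  proof (cases t rule: simple_rot.cases)
    case ("2_2" k t2)
    \<comment> \<open>If the left child were empty, its own child would weigh 1/2, too little for a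
      root of weight at least 2.\<close>
    have "46/100 * 2 < B * (1 + real (size1 t2))" using params
      by (intro mult_less_le_imp_less) (auto simp: size1_size)
    then show ?thesis using B "2_2" by simp
  qed (use B params in auto)
  then obtain t11 k1 t12 k t2 where eq: "t = \<langle>\<langle>t11, k1, t12\<rangle>, k, t2\<rangle>" by blast
  define a c d where "a = real (size1 t11)" and "c = real (size1 t12)" and "d = real (size1 t2)"
  note defs = a_def[symmetric] c_def[symmetric] d_def[symmetric]
  have bal: "all_bal t11" "all_bal t12" "all_bal t2" "balanced \<alpha> \<beta> \<langle>t11, k1, t12\<rangle>"
    using t by (auto simp: eq almost_balanced_def all_balanced_Node)
  have pos: "0 < a" "0 < c" "0 < d" by (simp_all add: a_def c_def d_def)
  have m: "a + c \<le> \<alpha> * (a + c + d)"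
    using t by (auto simp: eq almost_balanced_def all_dir a_def c_def d_def)
  have a: "a \<le> \<alpha> * (a + c)" using bal(4) by (simp add: balanced_Node Let_def defs)
  have "B * (a + c + d) \<le> a" using B by (simp add: eq a_def c_def d_def)
  note new = simple_rot_weights[OF pos refl m a this]
  show ?thesis
    using bal all_balanced_weight(1)[OF bal(1)] all_balanced_weight(1)[OF bal(2)]
      all_balanced_weight(1)[OF bal(3)] new
    unfolding eq
    by (fastforce simp: all_balanced_Node balanced_Node Let_def all_dir defs add.assoc
        intro: order_trans)
qed

lemma all_bal_double_rot:
  assumes t: "almost_bal t" and B: "B * real (size1 t) \<le> weight t [L, R]"
  shows "all_bal (double_rot t)"
proof -
  have "\<exists>t11 k1 t121 k12 t122 k t2. t = \<langle>\<langle>t11, k1, \<langle>t121, k12, t122\<rangle>\<rangle>, k, t2\<rangle>"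
  proof (cases t rule: double_rot.cases)
    case ("2_2" k t2)
    have "46/100 * 2 < B * (1 + real (size1 t2))" using params
      by (intro mult_less_le_imp_less) (auto simp: size1_size)
    then show ?thesis using B "2_2" by simp
  next
    case ("2_3" t11 k1 k t2)
    \<comment> \<open>An empty tree in the position to be lifted weighs 1, while the root then
      weighs at least 3.\<close>
    have "46/100 * 3 < B * (1 + real (size1 t11) + real (size1 t2))" using params
      by (intro mult_less_le_imp_less) (auto simp: size1_size)
    then show ?thesis using B "2_3" by (simp add: algebra_simps)
  qed (use B params in auto)
  then obtain t11 k1 t121 k12 t122 k t2
    where eq: "t = \<langle>\<langle>t11, k1, \<langle>t121, k12, t122\<rangle>\<rangle>, k, t2\<rangle>" by blast
  define a p q d where "a = real (size1 t11)" and "p = real (size1 t121)"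
    and "q = real (size1 t122)" and "d = real (size1 t2)"
  note defs = a_def[symmetric] p_def[symmetric] q_def[symmetric] d_def[symmetric]
  have bal: "all_bal t11" "all_bal t121" "all_bal t122" "all_bal t2"
    "balanced \<alpha> \<beta> \<langle>t11, k1, \<langle>t121, k12, t122\<rangle>\<rangle>" "balanced \<alpha> \<beta> \<langle>t121, k12, t122\<rangle>"
    using t by (auto simp: eq almost_balanced_def all_balanced_Node)
  have pos: "0 < a" "0 < p" "0 < q" "0 < d" by (simp_all add: a_def p_def q_def d_def)
  have m: "a + (p + q) \<le> \<alpha> * (a + (p + q) + d)"
    using t by (auto simp: eq almost_balanced_def all_dir a_def p_def q_def d_def)
  have c: "p + q \<le> \<alpha> * (a + (p + q))" and p2: "p \<le> \<beta> * (a + (p + q))" and q2: "q \<le> \<beta> * (a + (p + q))"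
    using bal(5) by (simp_all add: balanced_Node Let_def defs all_dir)
  have p1: "p \<le> \<alpha> * (p + q)" and q1: "q \<le> \<alpha> * (p + q)"
    and p3: "weight t121 [d] \<le> \<beta> * (p + q)" for d
    using bal(6) by (simp_all add: balanced_Node Let_def defs)
  have "B * (a + (p + q) + d) \<le> p + q" using B by (simp add: eq a_def p_def q_def d_def)
  note new = double_rot_weights[OF pos refl m c p1 p2 q1 q2 this]
  have "weight t121 [d] \<le> \<alpha> * p" for d
    using all_balanced_weight(1)[OF bal(2)] by (simp add: p_def)
  from new(14)[OF this p3] have w: "weight t121 [d] \<le> \<beta> * (a + p)" for d .
  have sums: "a + p + (q + d) = a + (p + q) + d" by simp
  show ?thesis
    using bal all_balanced_weight(1)[OF bal(1)] w
      all_balanced_weight(1)[OF bal(3)] all_balanced_weight(1)[OF bal(4)] new(1-13)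
    unfolding eq
    by (fastforce simp: all_balanced_Node balanced_Node Let_def all_dir defs sums
        intro: order_trans)
qed

text \<open>A weight above the threshold is at least \<open>B * n\<close>, as the rotation lemmas
  demand; if none is above it, all are at most \<open>\<beta> * n\<close>.\<close>

lemma all_bal_GC_balance:
  assumes t: "almost_bal t" and b: "B \<le> b" "b \<le> \<beta>"
  shows "all_bal (GC_balance b 0 t)"
proof -
  have n: "0 < real (size1 t)" by (simp add: size1_size)
  have B: "B * real (size1 t) \<le> w" if "w > b * real (size1 t)" for w
    using that mult_right_mono[OF b(1), of "real (size1 t)"] by linarith
  have m: "almost_bal (mirror t)" "size1 (mirror t) = size1 t" using t by (simp_all add: size1_size)
  show ?thesis
  proof (cases "\<forall>d e. weight t [d, e] \<le> b * real (size1 t)")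
    case True
    then have "GC_balance b 0 t = t" by (simp add: GC_balance_def Let_def leD)
    moreover have "b * real (size1 t) \<le> \<beta> * real (size1 t)" using b n by simp
    then have "weight t [d, e] \<le> \<beta> * real (size1 t)" for d e using True order_trans by blast
    then have "all_bal t"
      using t by (cases t) (auto simp: almost_balanced_def all_balanced_Node balanced_iff_weight)
    ultimately show ?thesis by simp
  next
    case False
    then show ?thesis
      using all_bal_simple_rot[OF t B] all_bal_double_rot[OF t B]
        all_bal_simple_rot[OF m(1)] all_bal_double_rot[OF m(1)] B
      unfolding GC_balance_def Let_def simple_rot_mirror_eq double_rot_mirror_eq all_dir
      by (auto simp: weight_mirror m(2) not_less)
  qed
qed

section \<open>C-balancing\<close>

text \<open>A non-redundant update of a tree with at least 12 nodes leaves a weight of at least 12, hence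
  raises the balance of the root by a factor of at most \<open>13/12\<close>.\<close>

definition C_defect :: "'a tree \<Rightarrow> bool" where
  "C_defect t \<longleftrightarrow> 12 \<le> size1 t \<and> (\<forall>d. weight t [d] \<le> 13/12 * \<alpha> * real (size1 t)) \<and>
    all_bal (left t) \<and> all_bal (right t)"

lemma C_defect_mirror [simp]: "C_defect (mirror t) = C_defect t"
  unfolding C_defect_def weight_mirror all_dir by (auto simp: size1_size)

text \<open>The state after a C-rotation: \<open>bal_GC\<close> may still fail at the root and at
  both children, which is what the three calls of GC-balancing repair.\<close>

definition C_fixed :: "'a tree \<Rightarrow> bool" where
  "C_fixed t \<longleftrightarrow> (\<forall>d. weight t [d] \<le> \<alpha> * real (size1 t)) \<and>
    almost_bal (left t) \<and> almost_bal (right t)"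

lemma C_fixed_mirror [simp]: "C_fixed (mirror t) = C_fixed t"
  unfolding C_fixed_def weight_mirror all_dir by (auto simp: size1_size)

text \<open>The second conclusion is needed because \<open>CGC_balance\<close> recognises a rotation
  by comparing trees.\<close>

lemma C_fixed_simple_rot:
  assumes t: "C_defect t" and m: "\<alpha> * real (size1 t) < weight t [L]"
    and h: "(1 - alpha_hat \<alpha>) * real (size1 t) \<le> weight t [L, L]"
  shows "C_fixed (simple_rot t)" "simple_rot t \<noteq> t"
proof -
  have "7/10 * 12 < \<alpha> * real (size1 t)"
    using t params by (intro mult_less_le_imp_less) (auto simp: C_defect_def)
  then have w: "1 < weight t [L]" using m by simp
  then obtain t11 k1 t12 k t2 where eq: "t = \<langle>\<langle>t11, k1, t12\<rangle>, k, t2\<rangle>"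
    by (cases t rule: simple_rot.cases) auto
  define a c d where "a = real (size1 t11)" and "c = real (size1 t12)" and "d = real (size1 t2)"
  note defs = a_def[symmetric] c_def[symmetric] d_def[symmetric]
  have bal: "all_bal t11" "all_bal t12" "all_bal t2" "balanced \<alpha> \<beta> \<langle>t11, k1, t12\<rangle>"
    using t by (auto simp: eq C_defect_def all_balanced_Node)
  have pos: "0 < a" "0 < c" "0 < d" by (simp_all add: a_def c_def d_def)
  have m1: "\<alpha> * (a + c + d) < a + c" using m by (simp add: eq a_def c_def d_def)
  have m2: "a + c \<le> 13/12 * \<alpha> * (a + c + d)"
    using t by (auto simp: eq C_defect_def all_dir a_def c_def d_def)
  have a: "a \<le> \<alpha> * (a + c)" using bal(4) by (simp add: balanced_Node Let_def defs)
  have "(1 - alpha_hat \<alpha>) * (a + c + d) \<le> a" using h by (simp add: eq a_def c_def d_def)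
  note new = C_simple_rot_weights[OF pos refl m1 m2 a this]
  show "C_fixed (simple_rot t)"
    using bal new all_balanced_imp_almost[OF bal(1)] unfolding eq
    by (simp add: C_fixed_def almost_balanced_def all_dir defs add.assoc)
  show "simple_rot t \<noteq> t" unfolding eq using arg_cong[of _ _ size] by fastforce
qed

lemma C_fixed_double_rot:
  assumes t: "C_defect t" and m: "\<alpha> * real (size1 t) < weight t [L]"
    and h: "weight t [L, L] < (1 - alpha_hat \<alpha>) * real (size1 t)"
  shows "C_fixed (double_rot t)" "double_rot t \<noteq> t"
proof -
  have N: "12 \<le> real (size1 t)" using t by (simp add: C_defect_def)
  have "7/10 * 12 < \<alpha> * real (size1 t)"
    using N params by (intro mult_less_le_imp_less) auto
  then have w: "1 < weight t [L]" using m by simp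
  \<comment> \<open>The node to be lifted is not empty: \<open>weight t [L]\<close> exceeds 70
    percent of a total weight of at least 12 and \<open>weight t [L, L]\<close> is below 35 percent,
    so more than 1 remains for it.\<close>
  have "17/10 * (1 - alpha_hat \<alpha>) \<le> (1 + \<alpha>) * (1 - alpha_hat \<alpha>)"
    using params alpha_hat_le by (intro mult_right_mono) auto
  also have "\<dots> \<le> 9/16" using alpha_hat_ge \<alpha>_square_le by (rule order_trans)
  finally have "1 - alpha_hat \<alpha> \<le> 35/100" by simp
  then have "(1 - alpha_hat \<alpha>) * real (size1 t) \<le> 35/100 * real (size1 t)"
    by (intro mult_right_mono) auto
  moreover have "7/10 * real (size1 t) \<le> \<alpha> * real (size1 t)" using params by (intro mult_right_mono) auto
  ultimately have "1 < weight t [L] - weight t [L, L]" using m h N by linarith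
  then obtain t11 k1 t121 k12 t122 k t2
    where eq: "t = \<langle>\<langle>t11, k1, \<langle>t121, k12, t122\<rangle>\<rangle>, k, t2\<rangle>"
    using w by (cases t rule: double_rot.cases) auto
  define a p q d where "a = real (size1 t11)" and "p = real (size1 t121)"
    and "q = real (size1 t122)" and "d = real (size1 t2)"
  note defs = a_def[symmetric] p_def[symmetric] q_def[symmetric] d_def[symmetric]
  have bal: "all_bal t11" "all_bal t121" "all_bal t122" "all_bal t2"
    "balanced \<alpha> \<beta> \<langle>t11, k1, \<langle>t121, k12, t122\<rangle>\<rangle>" "balanced \<alpha> \<beta> \<langle>t121, k12, t122\<rangle>"
    using t by (auto simp: eq C_defect_def all_balanced_Node)
  have pos: "0 < a" "0 < p" "0 < q" "0 < d" by (simp_all add: a_def p_def q_def d_def)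
  have m1: "\<alpha> * (a + (p + q) + d) < a + (p + q)"
    using m by (simp add: eq a_def p_def q_def d_def)
  have m2: "a + (p + q) \<le> 13/12 * \<alpha> * (a + (p + q) + d)"
    using t by (auto simp: eq C_defect_def all_dir a_def p_def q_def d_def)
  have c: "p + q \<le> \<alpha> * (a + (p + q))" using bal(5) by (simp add: balanced_Node Let_def defs)
  have p: "p \<le> \<alpha> * (p + q)" and q: "q \<le> \<alpha> * (p + q)"
    using bal(6) by (simp_all add: balanced_Node Let_def defs)
  have "a < (1 - alpha_hat \<alpha>) * (a + (p + q) + d)" using h by (simp add: eq a_def p_def q_def d_def)
  note new = C_double_rot_weights[OF pos refl m1 m2 c p q this]
  have sums: "a + p + (q + d) = a + (p + q) + d" by simp
  show "C_fixed (double_rot t)"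
    using bal new unfolding eq
    by (simp add: C_fixed_def almost_balanced_def all_dir defs sums)
  show "double_rot t \<noteq> t" unfolding eq using arg_cong[of _ _ size] by fastforce
qed

lemma C_balance_cases:
  assumes t: "C_defect t"
  defines "t1 \<equiv> C_balance \<alpha> (alpha_hat \<alpha>) 0 0 t"
  shows "t1 = t \<and> (\<forall>d. weight t [d] \<le> \<alpha> * real (size1 t)) \<or> t1 \<noteq> t \<and> C_fixed t1"
proof -
  have m: "C_defect (mirror t)" "size1 (mirror t) = size1 t" using t by (simp_all add: size1_size)
  have mirror: "mirror s \<noteq> t" if "s \<noteq> mirror t" for s using that by auto
  show ?thesis
    using C_fixed_simple_rot[OF t] C_fixed_double_rot[OF t]
      C_fixed_simple_rot[OF m(1)] C_fixed_double_rot[OF m(1)]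
    unfolding t1_def C_balance_def Let_def simple_rot_mirror_eq double_rot_mirror_eq all_dir
    by (auto simp: weight_mirror m(2) not_less not_le intro!: mirror)
qed

lemma all_bal_CGC_balance:
  assumes t: "C_defect t"
  shows "all_bal (CGC_balance \<alpha> (alpha_hat \<alpha>) \<beta> (beta_hat \<alpha> \<beta>) t)"
proof -
  define t1 where "t1 = C_balance \<alpha> (alpha_hat \<alpha>) 0 0 t"
  from C_balance_cases[OF t] consider
    "t1 = t" "\<forall>d. weight t [d] \<le> \<alpha> * real (size1 t)" | "t1 \<noteq> t" "C_fixed t1"
    unfolding t1_def by blast
  then show ?thesis
  proof cases
    case 1
    then have "almost_bal t" using t by (auto simp: almost_balanced_def C_defect_def)
    then have "all_bal (GC_balance \<beta> 0 t)" using params by (intro all_bal_GC_balance) auto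
    then show ?thesis using 1(1) by (simp add: CGC_balance_def t1_def)
  next
    case 2
    \<comment> \<open>GC-balancing a child keeps its size, so the bound on \<open>bal_C\<close> at
      the root survives.\<close>
    have "almost_bal (map_children (GC_balance (beta_hat \<alpha> \<beta>) 0) t1)"
      using 2(2) beta_hat_bounds
      by (cases t1) (auto simp: C_fixed_def almost_balanced_def all_dir intro!: all_bal_GC_balance)
    then show ?thesis
      using 2(1) beta_hat_bounds unfolding CGC_balance_def Let_def t1_def[symmetric]
      by (auto intro!: all_bal_GC_balance)
  qed
qed

end


section \<open>Updates\<close>

lemma set_tree_leaf_insert: "set_tree (leaf_insert x t) = insert x (set_tree t)"
  by (induction t) auto

lemma bst_leaf_insert: "bst t \<Longrightarrow> bst (leaf_insert x t)"
  by (induction t) (auto simp: set_tree_leaf_insert)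

lemma size_leaf_insert:
  "bst t \<Longrightarrow> size (leaf_insert x t) = (if x \<in> set_tree t then size t else Suc (size t))"
  by (induction t) auto

text \<open>Restructuring and rotations are invisible in the in-order sequence, so facts about sizes
  and order carry over from plain leaf insertion.\<close>

lemma inorder_bu_insert:
  assumes "restructuring f"
  shows "inorder (bu_insert f \<alpha> \<beta> x t) = inorder (leaf_insert x t)"
  using assms by (induction t) (auto simp: restructuring_def Let_def)

lemma bst_distinct_inorder: "bst t \<Longrightarrow> distinct (inorder t)"
  by (simp add: bst_iff_sorted_wrt_less strict_sorted_iff)

lemma hd_inorder_in: "t \<noteq> \<langle>\<rangle> \<Longrightarrow> hd (inorder t) \<in> set_tree t"
  and last_inorder_in: "t \<noteq> \<langle>\<rangle> \<Longrightarrow> last (inorder t) \<in> set_tree t"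
  by (metis eq_inorder_Nil hd_in_set set_inorder, metis eq_inorder_Nil last_in_set set_inorder)

text \<open>Moving the first key of \<open>inorder r\<close>, or the last one of
  \<open>inorder l\<close>, to the root and deleting it below leaves the sequence without
  \<open>a\<close>. Distinctness of the keys ensures that nothing else is removed.\<close>

lemma inorder_leaf_delete: "bst t \<Longrightarrow> inorder (leaf_delete x t) = removeAll x (inorder t)"
proof (induction t arbitrary: x)
  case (Node l a r)
  have bst: "bst l" "bst r" and l: "\<And>y. y \<in> set_tree l \<Longrightarrow> y < a" and r: "\<And>y. y \<in> set_tree r \<Longrightarrow> a < y"
    using Node.prems by auto
  have a: "a \<notin> set_tree l" "a \<notin> set_tree r" using l r by blast+
  consider "x < a" | "a < x" | "x = a" "r \<noteq> \<langle>\<rangle>" | "x = a" "r = \<langle>\<rangle>" "l \<noteq> \<langle>\<rangle>"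
    | "x = a" "r = \<langle>\<rangle>" "l = \<langle>\<rangle>"
    by fastforce
  then show ?case
  proof cases
    case 1
    then have "x \<notin> set_tree r" using r by fastforce
    then show ?thesis using 1 Node.IH(1)[OF bst(1)] by (simp add: removeAll_id)
  next
    case 2
    then have "x \<notin> set_tree l" using l by fastforce
    then show ?thesis using 2 Node.IH(2)[OF bst(2)] by (auto simp: removeAll_id)
  next
    case 3
    then obtain m xs where m: "inorder r = m # xs" by (cases "inorder r") auto
    then have "m \<notin> set xs" using bst_distinct_inorder[OF bst(2)] by simp
    moreover have "a \<noteq> m" "a \<notin> set xs" using a(2) unfolding set_inorder[symmetric] m by auto
    ultimately show ?thesis
      using 3 a(1) Node.IH(2)[OF bst(2), of m] m by (simp add: Let_def)
  next
    case 4
    then obtain m xs where m: "inorder l = xs @ [m]" by (cases "inorder l" rule: rev_cases) auto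
    then have "m \<notin> set xs" using bst_distinct_inorder[OF bst(1)] by simp
    moreover have "a \<noteq> m" "a \<notin> set xs" using a(1) unfolding set_inorder[symmetric] m by auto
    ultimately show ?thesis
      using 4 Node.IH(1)[OF bst(1), of m] m by (simp add: Let_def)
  qed simp
qed simp

lemma inorder_bu_delete:
  assumes "restructuring f"
  shows "inorder (bu_delete f \<alpha> \<beta> x t) = inorder (leaf_delete x t)"
proof (induction t arbitrary: x)
  case (Node l a r)
  \<comment> \<open>\<open>bu_delete\<close> omits the test on \<open>l\<close> that
    \<open>leaf_delete\<close> makes; in a tree of more than 11 nodes without right child,
    \<open>l\<close> cannot be empty.\<close>
  have "l \<noteq> \<langle>\<rangle>" if "size \<langle>l, a, r\<rangle> > 11" "r = \<langle>\<rangle>" using that by auto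
  then show ?case using assms Node by (auto simp: restructuring_def Let_def)
qed (use assms in \<open>auto simp: restructuring_def\<close>)

lemma size_bu_insert:
  assumes "restructuring f" "bst t"
  shows "size (bu_insert f \<alpha> \<beta> x t) = (if x \<in> set_tree t then size t else Suc (size t))"
  using size_eq_if_inorder_eq[OF inorder_bu_insert[OF assms(1)]] size_leaf_insert[OF assms(2)] by metis

lemma size_bu_delete:
  assumes "restructuring f" "bst t"
  shows "size (bu_delete f \<alpha> \<beta> x t) = (if x \<in> set_tree t then size t - 1 else size t)"
proof -
  have "inorder (bu_delete f \<alpha> \<beta> x t) = remove1 x (inorder t)"
    using inorder_bu_delete[OF assms(1)] inorder_leaf_delete[OF assms(2)]
      distinct_remove1_removeAll[OF bst_distinct_inorder[OF assms(2)]] by metis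
  from arg_cong[OF this, of length] show ?thesis by (simp add: length_remove1)
qed

lemma bst_bu_insert:
  assumes "restructuring f" "bst t"
  shows "bst (bu_insert f \<alpha> \<beta> x t)"
  using bst_leaf_insert[OF assms(2)] by (simp add: bst_iff_sorted_wrt_less inorder_bu_insert[OF assms(1)])

lemma bst_bu_delete:
  assumes "restructuring f" "bst t"
  shows "bst (bu_delete f \<alpha> \<beta> x t)"
  using assms(2) inorder_bu_delete[OF assms(1)] inorder_leaf_delete[OF assms(2)]
  by (simp add: bst_iff_sorted_wrt_less removeAll_filter_not_eq sorted_wrt_filter)

text \<open>Only the weights of the children are claimed to be kept: deeper down, a small sub-tree
  may be restructured even by a redundant update.\<close>

lemma weight_eq_if_redundant_insert:
  assumes "restructuring f" "bst t" "11 < size t" "x \<in> set_tree t"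
  shows "weight (bu_insert f \<alpha> \<beta> x t) [d] = weight t [d]"
proof (cases t)
  case (Node l a r)
  then show ?thesis
    using assms size_bu_insert[OF assms(1)] by (fastforce simp: Let_def size1_size)
qed (use assms in simp)

lemma weight_eq_if_redundant_delete:
  assumes "restructuring f" "bst t" "11 < size t" "x \<notin> set_tree t"
  shows "weight (bu_delete f \<alpha> \<beta> x t) [d] = weight t [d]"
proof (cases t)
  case (Node l a r)
  then show ?thesis
    using assms size_bu_delete[OF assms(1)] by (fastforce simp: Let_def size1_size)
qed (use assms in simp)

section \<open>Perfectly balanced trees\<close>

lemma wbalanced_bu_insert:
  "restructuring f \<Longrightarrow> size t \<le> 11 \<Longrightarrow> wbalanced (bu_insert f \<alpha> \<beta> x t)"
  by (cases t) (auto simp: restructuring_def)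

lemma wbalanced_bu_delete:
  "restructuring f \<Longrightarrow> size t \<le> 11 \<Longrightarrow> wbalanced (bu_delete f \<alpha> \<beta> x t)"
  by (cases t) (auto simp: restructuring_def)

lemma weight_le_if_wbalanced: "wbalanced t \<Longrightarrow> 2 * weight t [d] \<le> real (size1 t) + 1"
  by (cases t) (auto simp: size1_size)

text \<open>The extreme cases are children of weights 2 and 1, with ratio 2/3, and a grandchild of
  weight 2 below children of weights 3 and 2, with ratio 2/5.\<close>

lemma wbalanced_Node_weights:
  assumes "wbalanced l" "size l \<le> Suc (size r)"
  shows "3 * real (size1 l) \<le> 2 * (real (size1 l) + real (size1 r))"
    "5 * weight l [d] \<le> 2 * (real (size1 l) + real (size1 r))"
proof -
  show "3 * real (size1 l) \<le> 2 * (real (size1 l) + real (size1 r))"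
    using assms by (simp add: size1_size)
  show "5 * weight l [d] \<le> 2 * (real (size1 l) + real (size1 r))"
  proof (cases l)
    case (Node ll a lr)
    define k where "k = (if d = L then size1 ll else size1 lr)"
    have "2 * k \<le> size1 l + 1" "k < size1 l" using assms(1) Node by (auto simp: k_def size1_size)
    then have "5 * k \<le> 2 * (size1 l + size1 r)" using assms(2) by (simp add: size1_size)
    then have "real (5 * k) \<le> real (2 * (size1 l + size1 r))" by (simp only: of_nat_le_iff)
    then show ?thesis using Node by (simp add: k_def split: if_splits)
  qed (simp add: size1_size)
qed

section \<open>Updates preserve balance\<close>

context gcb_parameters
begin

lemma all_bal_if_wbalanced: "wbalanced t \<Longrightarrow> all_bal t"
proof (induction t)
  case (Node l a r)
  define n where "n = real (size1 l) + real (size1 r)"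
  have sz: "size l \<le> Suc (size r)" "size r \<le> Suc (size l)" using Node.prems by auto
  have wb: "wbalanced l" "wbalanced r" using Node.prems by auto
  have "0 < n" by (simp add: n_def size1_size)
  then have "2/3 * n \<le> \<alpha> * n" "2/5 * n \<le> \<beta> * n" using params by simp_all
  then have "balanced \<alpha> \<beta> \<langle>l, a, r\<rangle>"
    using wbalanced_Node_weights[OF wb(1) sz(1)] wbalanced_Node_weights[OF wb(2) sz(2)]
    unfolding balanced_Node Let_def n_def[symmetric]
    by (simp add: n_def[symmetric] add.commute[of "real (size1 r)"]) (smt (verit))
  then show ?case using Node by (simp add: all_balanced_Node)
qed simp

text \<open>Deletion is the critical case:
  \<open>\<alpha> * n \<le> 13/12 * \<alpha> * (n - 1)\<close> is an equality at
  \<open>n = 13\<close>, the least weight of a tree with more than 11 nodes.\<close>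

lemma C_defect_update:
  assumes "all_bal \<langle>l, a, r\<rangle>" "all_bal l'" "all_bal r'" "11 < size \<langle>l, a, r\<rangle>"
    and "size l' = Suc (size l) \<and> size r' = size r \<or> size l' = size l \<and> size r' = Suc (size r) \<or>
      Suc (size l') = size l \<and> size r' = size r \<or> size l' = size l \<and> Suc (size r') = size r"
  shows "C_defect \<langle>l', b, r'\<rangle>"
proof -
  define n where "n = real (size1 l) + real (size1 r)"
  have n: "13 \<le> n" using assms(4) by (simp add: n_def size1_size)
  then have \<alpha>n: "13 * \<alpha> \<le> \<alpha> * n" using params by simp
  have lr: "real (size1 l) \<le> \<alpha> * n" "real (size1 r) \<le> \<alpha> * n"
    using all_balanced_imp_balanced[OF assms(1)] by (simp_all add: balanced_Node Let_def n_def)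
  consider "real (size1 l') + real (size1 r') = n + 1"
      "real (size1 l') \<le> real (size1 l) + 1" "real (size1 r') \<le> real (size1 r) + 1"
    | "real (size1 l') + real (size1 r') = n - 1"
      "real (size1 l') \<le> real (size1 l)" "real (size1 r') \<le> real (size1 r)"
    using assms(5) unfolding n_def size1_size by force
  then have "real (size1 l') \<le> 13/12 * \<alpha> * (real (size1 l') + real (size1 r'))
      \<and> real (size1 r') \<le> 13/12 * \<alpha> * (real (size1 l') + real (size1 r'))"
  proof cases
    case 1
    have "13/12 * \<alpha> * (n + 1) = 13/12 * (\<alpha> * n) + 13/12 * \<alpha>" by (simp add: algebra_simps)
    then show ?thesis unfolding 1(1) using 1(2,3) lr \<alpha>n \<alpha>_gt by linarith
  next
    case 2
    have "13/12 * \<alpha> * (n - 1) = 13/12 * (\<alpha> * n) - 13/12 * \<alpha>" by (simp add: field_simps)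
    then show ?thesis unfolding 2(1) using 2(2,3) lr \<alpha>n by linarith
  qed
  moreover have "12 \<le> size1 \<langle>l', b, r'\<rangle>" using assms(4,5) by (auto simp: size1_size)
  ultimately show ?thesis using assms(2,3) by (simp add: C_defect_def all_dir)
qed

text \<open>No rebalancing follows a redundant update, yet grandchildren of the root may have
  changed weight if the child was a small tree and got restructured. Being perfectly balanced, that
  child then splits nearly in half.\<close>

lemma all_bal_redundant:
  assumes bal: "all_bal \<langle>l, a, r\<rangle>" and l': "all_bal l'" and size: "11 < size \<langle>l, a, r\<rangle>" "size l' = size l"
    and shape: "wbalanced l' \<or> (\<forall>d. weight l' [d] = weight l [d])"
  shows "all_bal \<langle>l', b, r\<rangle>"
proof -
  define n where "n = real (size1 l) + real (size1 r)"
  have n: "13 \<le> n" using size by (simp add: n_def size1_size)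
  have bal': "real (size1 l) \<le> \<alpha> * n" "real (size1 r) \<le> \<alpha> * n"
    "weight l [d] \<le> \<beta> * n" "weight r [d] \<le> \<beta> * n" for d
    using all_balanced_imp_balanced[OF bal] by (simp_all add: balanced_Node Let_def n_def)
  have l'n: "real (size1 l') = real (size1 l)" using size by (simp add: size1_size)
  \<comment> \<open>Half of \<open>3/4 * n + 1\<close> is at most \<open>46/100 * n\<close> once
    \<open>n \<ge> 13\<close>.\<close>
  have "46/100 * n \<le> \<beta> * n" "\<alpha> * n \<le> 3/4 * n" using params n by simp_all
  then have "wbalanced l' \<Longrightarrow> weight l' [d] \<le> \<beta> * n" for d
    using bal'(1) weight_le_if_wbalanced[of l' d] n l'n by linarith
  then have "weight l' [d] \<le> \<beta> * n" for d using shape bal'(3) by metis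
  then have "balanced \<alpha> \<beta> \<langle>l', b, r\<rangle>"
    using bal' by (simp add: balanced_Node Let_def l'n n_def[symmetric])
  then show ?thesis using bal l' by (simp add: all_balanced_Node)
qed

lemma all_bal_redundant_right:
  assumes "all_bal \<langle>l, a, r\<rangle>" "all_bal r'" "11 < size \<langle>l, a, r\<rangle>" "size r' = size r"
    and "wbalanced r' \<or> (\<forall>d. weight r' [d] = weight r [d])"
  shows "all_bal \<langle>l, b, r'\<rangle>"
proof -
  have wb: "wbalanced (mirror t) = wbalanced t" for t :: "'b tree"
    by (induction t) (auto simp: abs_minus_commute)
  have "all_bal (mirror \<langle>l, a, r\<rangle>)" using assms(1) by (simp only: all_balanced_mirror)
  then have "all_bal (mirror \<langle>l, b, r'\<rangle>)"
    using assms(2-5) all_bal_redundant[of "mirror r" a "mirror l" "mirror r'" b]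
    by (auto simp: weight_mirror wb)
  then show ?thesis by (simp only: all_balanced_mirror)
qed

text \<open>A non-redundant update changes one child's size by one, so that \<open>C_defect\<close>
  holds and \<open>CGC_balance\<close> repairs the tree; a redundant one falls under
  \<open>all_bal_redundant\<close> or its reflection.\<close>

lemma all_bal_bu_insert:
  assumes f: "restructuring f"
  shows "bst t \<Longrightarrow> all_bal t \<Longrightarrow> all_bal (bu_insert f \<alpha> \<beta> x t)"
proof (induction t)
  case Leaf
  show ?case by (rule all_bal_if_wbalanced[OF wbalanced_bu_insert[OF f]]) simp
next
  case (Node l a r)
  have bst: "bst l" "bst r" using Node.prems by auto
  have bal: "all_bal l" "all_bal r" using Node.prems by (auto simp: all_balanced_Node)
  note IH = Node.IH(1)[OF bst(1) bal(1)] Node.IH(2)[OF bst(2) bal(2)]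
  note sizes = size_bu_insert[OF f bst(1), of \<alpha> \<beta> x] size_bu_insert[OF f bst(2), of \<alpha> \<beta> x]
  have shape: "wbalanced (bu_insert f \<alpha> \<beta> x s) \<or> (\<forall>d. weight (bu_insert f \<alpha> \<beta> x s) [d] = weight s [d])"
    if "bst s" "x \<in> set_tree s" for s
    using that wbalanced_bu_insert[OF f] weight_eq_if_redundant_insert[OF f]
    by (metis linorder_not_less)
  show ?case
  proof (cases "size \<langle>l, a, r\<rangle> \<le> 11")
    case True
    then show ?thesis using wbalanced_bu_insert[OF f] all_bal_if_wbalanced by blast
  next
    case False
    then have size: "11 < size \<langle>l, a, r\<rangle>" by simp
    note defect = C_defect_update[OF Node.prems(2) _ _ size, THEN all_bal_CGC_balance]
    note redundant = all_bal_redundant[OF Node.prems(2) _ size] all_bal_redundant_right[OF Node.prems(2) _ size]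
    consider "x < a" "x \<in> set_tree l" | "x < a" "x \<notin> set_tree \<langle>l, a, r\<rangle>"
      | "a < x" "x \<in> set_tree r" | "a < x" "x \<notin> set_tree \<langle>l, a, r\<rangle>" | "x = a"
      using Node.prems(1) by fastforce
    then show ?thesis
    proof cases
      case 1
      then show ?thesis using size IH sizes shape[OF bst(1)] redundant(1) by simp
    next
      case 2
      then show ?thesis using size IH sizes bal by (simp add: defect)
    next
      case 3
      then show ?thesis using size IH sizes shape[OF bst(2)] redundant(2) by (simp add: less_not_sym)
    next
      case 4
      then show ?thesis using size IH sizes bal by (simp add: defect)
    next
      case 5
      then show ?thesis using size Node.prems(2) by simp
    qed
  qed
qed

lemma all_bal_bu_delete:
  assumes f: "restructuring f"
  shows "bst t \<Longrightarrow> all_bal t \<Longrightarrow> all_bal (bu_delete f \<alpha> \<beta> x t)"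
proof (induction t arbitrary: x)
  case Leaf
  show ?case by (rule all_bal_if_wbalanced[OF wbalanced_bu_delete[OF f]]) simp
next
  case (Node l a r)
  have bst: "bst l" "bst r" using Node.prems by auto
  have bal: "all_bal l" "all_bal r" using Node.prems by (auto simp: all_balanced_Node)
  note IH = Node.IH(1)[OF bst(1) bal(1)] Node.IH(2)[OF bst(2) bal(2)]
  note sizes = size_bu_delete[OF f bst(1)] size_bu_delete[OF f bst(2)]
  have shape: "wbalanced (bu_delete f \<alpha> \<beta> x s) \<or> (\<forall>d. weight (bu_delete f \<alpha> \<beta> x s) [d] = weight s [d])"
    if "bst s" "x \<notin> set_tree s" for s
    using that wbalanced_bu_delete[OF f] weight_eq_if_redundant_delete[OF f]
    by (metis linorder_not_less)
  show ?case
  proof (cases "size \<langle>l, a, r\<rangle> \<le> 11")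
    case True
    then show ?thesis using wbalanced_bu_delete[OF f] all_bal_if_wbalanced by blast
  next
    case False
    then have size: "11 < size \<langle>l, a, r\<rangle>" by simp
    note defect = C_defect_update[OF Node.prems(2) _ _ size, THEN all_bal_CGC_balance]
    note redundant = all_bal_redundant[OF Node.prems(2) _ size] all_bal_redundant_right[OF Node.prems(2) _ size]
    \<comment> \<open>\<open>size_bu_delete\<close> subtracts on natural numbers, so the sub-tree
      must be known to be nonempty.\<close>
    have pos: "0 < size s" if "y \<in> set_tree s" for y and s :: "'b tree" using that by (cases s) auto
    \<comment> \<open>The key \<open>y\<close> and the root key \<open>b\<close> are left general,
      so that deleting a predecessor or successor and copying its key to the root is covered as
      well.\<close>
    have step_l: "all_bal (CGC_balance \<alpha> (alpha_hat \<alpha>) \<beta> (beta_hat \<alpha> \<beta>) \<langle>bu_delete f \<alpha> \<beta> y l, b, r\<rangle>)"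
      if "y \<in> set_tree l" for y b
      using that pos[OF that] IH(1) sizes(1) bal by (intro defect) auto
    have step_r: "all_bal (CGC_balance \<alpha> (alpha_hat \<alpha>) \<beta> (beta_hat \<alpha> \<beta>) \<langle>l, b, bu_delete f \<alpha> \<beta> y r\<rangle>)"
      if "y \<in> set_tree r" for y b
      using that pos[OF that] IH(2) sizes(2) bal by (intro defect) auto
    consider "x < a" "x \<in> set_tree l" | "x < a" "x \<notin> set_tree \<langle>l, a, r\<rangle>"
      | "a < x" "x \<in> set_tree r" | "a < x" "x \<notin> set_tree \<langle>l, a, r\<rangle>"
      | "x = a" "r \<noteq> \<langle>\<rangle>" | "x = a" "r = \<langle>\<rangle>" "l \<noteq> \<langle>\<rangle>"
      using Node.prems(1) size by fastforce
    then show ?thesis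
    proof cases
      case 1
      then show ?thesis using size step_l by simp
    next
      case 2
      then show ?thesis using size IH(1) sizes shape[OF bst(1)] redundant(1) by simp
    next
      case 3
      then show ?thesis using size step_r by (simp add: less_not_sym)
    next
      case 4
      then show ?thesis using size IH(2) sizes shape[OF bst(2)] redundant(2) by (simp add: less_not_sym)
    next
      case 5
      then show ?thesis using size step_r[OF hd_inorder_in] by (simp add: Let_def)
    next
      case 6
      then show ?thesis using size step_l[OF last_inorder_in] by (simp add: Let_def)
    qed
  qed
qed

lemma GCB_iff: "GCB \<alpha> \<beta> t \<longleftrightarrow> bst t \<and> all_bal t"
  using all_balanced_imp_balanced[OF all_bal_Leaf] unfolding GCB_def all_balanced_def by metis

end

theorem theorem3:
  fixes \<alpha> \<beta> :: real and T :: "'a::linorder tree" and f :: "'a tree \<Rightarrow> 'a tree" and x :: 'a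
  assumes "1 / sqrt 2 \<le> \<alpha>" and "\<alpha> < 3/4"
    and "B_thr \<alpha> \<le> \<beta>" and "\<beta> \<le> \<alpha>\<^sup>2"
    and "restructuring f"
    and "GCB \<alpha> \<beta> T"
  shows "GCB \<alpha> \<beta> (bu_insert f \<alpha> \<beta> x T) \<and> GCB \<alpha> \<beta> (bu_delete f \<alpha> \<beta> x T)"
proof -
  have "0 < 1 / sqrt 2" by simp
  then have \<alpha>: "0 < \<alpha>" using assms(1) by linarith
  have "(sqrt (1 + 4 * \<alpha>))\<^sup>2 = 1 + 4 * \<alpha>" using \<alpha> by (intro real_sqrt_pow2) simp
  then have "\<alpha> = B_thr \<alpha> + B_thr \<alpha> * B_thr \<alpha>"
    unfolding B_thr_def by (simp add: power2_eq_square field_simps)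
  moreover have "0 < B_thr \<alpha>" unfolding B_thr_def using \<alpha> by simp
  moreover have "1 \<le> 2 * \<alpha>\<^sup>2" using power_mono[OF assms(1), of 2] by (simp add: power_divide)
  ultimately interpret gcb_parameters \<alpha> \<beta> "B_thr \<alpha>"
    using assms \<alpha> by unfold_locales (auto simp: power2_eq_square)
  show ?thesis
    using assms(5,6) all_bal_bu_insert all_bal_bu_delete bst_bu_insert bst_bu_delete
    unfolding GCB_iff by blast
qed

end
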